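(* Let $f$ be an oriented hexagonal fully packed loop configuration (oriented HFPL) of size $(K,L,M,N)$ with boundary $(l_T,t,r_T;r_B,b,l_B)$. Then $$d(r_B)+d(b)+d(l_B)-d(l_T)-d(t)-d(r_T)-|l_T|_1|t|_0-|t|_1|r_T|_0-|r_B|_0|l_B|_1$$ equals the sum of the numbers of occurrences in $f$ of the following eight local configurations: (i) a vertical edge directed downwards from an odd vertex to an even vertex; (ii) a vertical edge directed upwards from an even vertex to an odd vertex; (iii) two consecutive edges, both directed to the left, whose middle vertex is odd; (iv) two consecutive edges, both directed to the left, whose middle vertex is even; (v) an edge directed downwards followed by an edge directed to the left, whose common vertex is even; (vi) an edge directed upwards followed by an edge directed to the left, whose common vertex is odd; (vii) an edge directed to the left followed by an edge directed downwards, whose common vertex is odd; (viii) an edge directed to the left followed by an edge directed upwards, whose common vertex is even.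
   Context: Words. A word is a finite sequence over $\{0,1\}$; $|\omega|_i$ is the number of occurrences of $i$ in $\omega$; $d(\omega)$ is the number of pairs $i<j$ with $\omega_i=1,\omega_j=0$. Graph. Let $K,L,M,N\ge0$ be integers with $K\le M+N$, $N\le K+L$, and $M+N\ge 1$. $H^{K,L,M,N}$ is the induced subgraph of the square lattice $\mathbb Z^2$ (edges join points at distance 1) on the vertices $(x,y)\in\mathbb Z^2$ with $y\le x$, $y\le K-1$, $y\le -x+2(K+L)$, $y\ge -x-1$, $y\ge -M-N+K$, $y\ge x-2(M+L)-1$. A vertex $(x,y)$ is called odd if $x+y$ is an even integer, and even if $x+y$ is an odd integer (so, for $K\geq 1$, the leftmost vertex of the top row is odd). Put $s=M+N-K$. Distinguished vertices: $\mathcal L_T=\{L_{T,i}=(i-1,i-1):1\le i\le K\}$ (leftmost vertices of the top $K$ rows); $\mathcal T=\{T_i=(K-1+2i,K-1):1\le i\le L\}$ (odd vertices of the top row not in $\mathcal L_T\cup\mathcal R_T$); $\mathcal R_T=\{R_{T,i}=(K+2L+i,K-i):1\le i\le M\}$ (rightmost vertices of the top $M$ rows); $\mathcal L_B=\{L_{B,i}=(i-1,-i):1\le i\le s\}$ (leftmost vertices of the bottom $s$ rows); $\mathcal B=\{B_i=(s-1+2i,-s):1\le i\le K+L-N\}$ (even vertices of the bottom row not in $\mathcal L_B\cup\mathcal R_B$); $\mathcal R_B=\{R_{B,i}=(K+M-N+2L+i,\,K-M-N-1+i):1\le i\le N\}$ (rightmost vertices of the bottom $N$ rows). HFPL. An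 HFPL of size $(K,L,M,N)$ is a spanning subgraph $f$ of $H^{K,L,M,N}$ such that vertices in $\mathcal L_B\cup\mathcal L_T\cup\mathcal R_B\cup\mathcal R_T$ have degree 0 or 1, vertices in $\mathcal T\cup\mathcal B$ have degree 1, all other vertices have degree 2, and no path of $f$ joins two vertices of $\mathcal L_B\cup\mathcal L_T$ or two vertices of $\mathcal R_B\cup\mathcal R_T$. Oriented HFPL. An HFPL with an orientation of each edge such that each vertex of degree 2 has one incoming and one outgoing edge, each edge attached to a vertex of $\mathcal L_T\cup\mathcal L_B$ is outgoing from it, and each edge attached to a vertex of $\mathcal R_T\cup\mathcal R_B$ is incoming to it. Its boundary $(l_T,t,r_T;r_B,b,l_B)$ (words of lengths $K,L,M,N,K+L-N,M+N-K$) is given by: $(l_T)_i=1$ if $L_{T,i}$ has out-degree 1, else 0; $t_i=0$ if $T_i$ has in-degree 1, else 1; $(r_T)_i=0$ if $R_{T,i}$ has in-degree 1, else 1; $(r_B)_i=1$ if $R_{B,i}$ has in-degree 1, else 0; $b_i=1$ if $B_i$ has in-degree 1, else 0; $(l_B)_i=0$ if $L_{B,i}$ has out-degree 1, else 1. Directions: left $=(-1,0)$, up $=(0,1)$, down $=(0,-1)$. "An edge $e$ followed by an edge $e'$" means that the head of $e$ is the tail of $e'$. *)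

theory Defs
  imports "HOL-Library.Z2" "HOL-Library.Product_Plus"
begin

type_synonym word = "bit list"

definition word_d :: "word \<Rightarrow> nat" where
  "word_d w = card {(i, j). i < j \<and> j < length w \<and> w ! i = 1 \<and> w ! j = 0}"

type_synonym vertex = "int \<times> int"

definition H_verts :: "nat \<Rightarrow> nat \<Rightarrow> nat \<Rightarrow> nat \<Rightarrow> vertex set" where
  "H_verts K L M N = {(x, y).
     y \<le> x \<and> y \<le> int K - 1 \<and> y \<le> - x + 2 * (int K + int L) \<and>
     y \<ge> - x - 1 \<and> y \<ge> - int M - int N + int K \<and> y \<ge> x - 2 * (int M + int L) - 1}"

text \<open>An undirected edge is the two-element set of its end points.\<close>

definition H_edges :: "nat \<Rightarrow> nat \<Rightarrow> nat \<Rightarrow> nat \<Rightarrow> vertex set set" where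
  "H_edges K L M N = {{u, v} | u v. u \<in> H_verts K L M N \<and> v \<in> H_verts K L M N \<and>
     \<bar>fst u - fst v\<bar> + \<bar>snd u - snd v\<bar> = 1}"

text \<open>
  The parity of a vertex is opposite to the parity of the sum of its coordinates:
  with this convention the leftmost vertex of the top row, (K - 1, K - 1), is odd if K \<ge> 1.
\<close>

definition odd_vertex :: "vertex \<Rightarrow> bool" where
  "odd_vertex v \<longleftrightarrow> even (fst v + snd v)"

definition even_vertex :: "vertex \<Rightarrow> bool" where
  "even_vertex v \<longleftrightarrow> odd (fst v + snd v)"

definition LT :: "nat \<Rightarrow> vertex" where
  "LT i = (int i - 1, int i - 1)"

definition TT :: "nat \<Rightarrow> nat \<Rightarrow> vertex" where
  "TT K i = (int K - 1 + 2 * int i, int K - 1)"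

definition RT :: "nat \<Rightarrow> nat \<Rightarrow> nat \<Rightarrow> vertex" where
  "RT K L i = (int K + 2 * int L + int i, int K - int i)"

definition LB :: "nat \<Rightarrow> vertex" where
  "LB i = (int i - 1, - int i)"

definition BB :: "nat \<Rightarrow> nat \<Rightarrow> nat \<Rightarrow> nat \<Rightarrow> vertex" where
  "BB K M N i = (let s = int M + int N - int K in (s - 1 + 2 * int i, - s))"

definition RB :: "nat \<Rightarrow> nat \<Rightarrow> nat \<Rightarrow> nat \<Rightarrow> nat \<Rightarrow> vertex" where
  "RB K L M N i = (int K + int M - int N + 2 * int L + int i, int K - int M - int N - 1 + int i)"

text \<open>
  The truncated subtractions below are harmless: a size satisfies
  K \<le> M + N and N \<le> K + L.
\<close>

definition left_verts :: "nat \<Rightarrow> nat \<Rightarrow> nat \<Rightarrow> nat \<Rightarrow> vertex set" where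
  "left_verts K L M N = LT ` {1..K} \<union> LB ` {1..M + N - K}"

definition right_verts :: "nat \<Rightarrow> nat \<Rightarrow> nat \<Rightarrow> nat \<Rightarrow> vertex set" where
  "right_verts K L M N = RT K L ` {1..M} \<union> RB K L M N ` {1..N}"

definition mid_verts :: "nat \<Rightarrow> nat \<Rightarrow> nat \<Rightarrow> nat \<Rightarrow> vertex set" where
  "mid_verts K L M N = TT K ` {1..L} \<union> BB K M N ` {1..K + L - N}"

definition degree :: "vertex set set \<Rightarrow> vertex \<Rightarrow> nat" where
  "degree f v = card {e \<in> f. v \<in> e}"

definition is_path :: "vertex set set \<Rightarrow> vertex list \<Rightarrow> bool" where
  "is_path f p \<longleftrightarrow> p \<noteq> [] \<and> distinct p \<and> successively (\<lambda>u v. {u, v} \<in> f) p"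

definition joined_in :: "vertex set set \<Rightarrow> vertex set \<Rightarrow> bool" where
  "joined_in f S \<longleftrightarrow> (\<exists>p. is_path f p \<and> hd p \<in> S \<and> last p \<in> S \<and> hd p \<noteq> last p)"

text \<open>A spanning subgraph of H is given by its set of edges.\<close>

definition hfpl :: "nat \<Rightarrow> nat \<Rightarrow> nat \<Rightarrow> nat \<Rightarrow> vertex set set \<Rightarrow> bool" where
  "hfpl K L M N f \<longleftrightarrow>
     f \<subseteq> H_edges K L M N \<and>
     (\<forall>v \<in> left_verts K L M N \<union> right_verts K L M N. degree f v = 0 \<or> degree f v = 1) \<and>
     (\<forall>v \<in> mid_verts K L M N. degree f v = 1) \<and>
     (\<forall>v \<in> H_verts K L M N - (left_verts K L M N \<union> right_verts K L M N \<union> mid_verts K L M N).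
        degree f v = 2) \<and>
     \<not> joined_in f (left_verts K L M N) \<and>
     \<not> joined_in f (right_verts K L M N)"

text \<open>A directed edge is the pair (tail, head).\<close>

definition orientation :: "vertex set set \<Rightarrow> (vertex \<times> vertex) set \<Rightarrow> bool" where
  "orientation f D \<longleftrightarrow>
     (\<forall>u v. (u, v) \<in> D \<longrightarrow> {u, v} \<in> f) \<and>
     (\<forall>u v. {u, v} \<in> f \<longrightarrow> ((u, v) \<in> D) \<noteq> ((v, u) \<in> D))"

definition in_deg :: "(vertex \<times> vertex) set \<Rightarrow> vertex \<Rightarrow> nat" where
  "in_deg D v = card {u. (u, v) \<in> D}"

definition out_deg :: "(vertex \<times> vertex) set \<Rightarrow> vertex \<Rightarrow> nat" where
  "out_deg D v = card {u. (v, u) \<in> D}"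

definition oriented_hfpl ::
  "nat \<Rightarrow> nat \<Rightarrow> nat \<Rightarrow> nat \<Rightarrow> vertex set set \<Rightarrow> (vertex \<times> vertex) set \<Rightarrow> bool" where
  "oriented_hfpl K L M N f D \<longleftrightarrow>
     hfpl K L M N f \<and> orientation f D \<and>
     (\<forall>v \<in> H_verts K L M N. degree f v = 2 \<longrightarrow> in_deg D v = 1 \<and> out_deg D v = 1) \<and>
     (\<forall>v \<in> left_verts K L M N. \<forall>u. (u, v) \<notin> D) \<and>
     (\<forall>v \<in> right_verts K L M N. \<forall>u. (v, u) \<notin> D)"

text \<open>The components are listed in the order l_T, t, r_T, r_B, b, l_B.\<close>

definition boundary ::
  "nat \<Rightarrow> nat \<Rightarrow> nat \<Rightarrow> nat \<Rightarrow> (vertex \<times> vertex) set \<Rightarrow>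
     word \<times> word \<times> word \<times> word \<times> word \<times> word" where
  "boundary K L M N D =
    (map (\<lambda>i. if out_deg D (LT i) = 1 then 1 else 0) [1..<K + 1],
     map (\<lambda>i. if in_deg D (TT K i) = 1 then 0 else 1) [1..<L + 1],
     map (\<lambda>i. if in_deg D (RT K L i) = 1 then 0 else 1) [1..<M + 1],
     map (\<lambda>i. if in_deg D (RB K L M N i) = 1 then 1 else 0) [1..<N + 1],
     map (\<lambda>i. if in_deg D (BB K M N i) = 1 then 1 else 0) [1..<K + L - N + 1],
     map (\<lambda>i. if out_deg D (LB i) = 1 then 0 else 1) [1..<M + N - K + 1])"

abbreviation dir_left :: vertex where "dir_left \<equiv> (-1, 0)"
abbreviation dir_up :: vertex where "dir_up \<equiv> (0, 1)"
abbreviation dir_down :: vertex where "dir_down \<equiv> (0, -1)"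

definition num_edges ::
  "(vertex \<times> vertex) set \<Rightarrow> vertex \<Rightarrow> (vertex \<Rightarrow> bool) \<Rightarrow> (vertex \<Rightarrow> bool) \<Rightarrow> nat" where
  "num_edges D a P Q = card {(u, v). (u, v) \<in> D \<and> v - u = a \<and> P u \<and> Q v}"

text \<open>
  Number of edges with direction a followed by an edge with direction b, whose common
  vertex satisfies P.
\<close>

definition num_turns ::
  "(vertex \<times> vertex) set \<Rightarrow> vertex \<Rightarrow> vertex \<Rightarrow> (vertex \<Rightarrow> bool) \<Rightarrow> nat" where
  "num_turns D a b P =
     card {(u, v, w). (u, v) \<in> D \<and> (v, w) \<in> D \<and> v - u = a \<and> w - v = b \<and> P v}"

end

theory Submission
  imports Defs
begin

text \<open>
  Call the link between (x, y) and (x + 1, y) blue if (x, y) is an odd vertex and red otherwise, and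
  say that it carries a particle of its colour unless the edge across it is directed to the right.
  Sweeping x from right to left, the edges from odd to even vertices move the blue particles and
  those from even to odd vertices move the red ones: a vertical edge moves a particle by one row,
  and an edge directed to the left makes a particle skip over a link of the other colour. Particles
  are created and destroyed only at the boundary, at the places recorded by the boundary words.

  Two conservation arguments give the theorem. Balancing x + y along the blue and x - y along the
  red currents expresses the number of edges directed to the left plus that of the vertical edges
  with an odd upper end through the boundary words. The pairing of blue with red particles of one
  column, weighted by the sign of their height difference, changes only where a blue and a red
  particle meet at an edge directed to the left, and at the boundary: a discrete Stokes formula for
  the signed number of blue-red crossings. The eight local configurations count the former
  number minus the latter.
\<close>

section \<open>Sums over a grid\<close>

text \<open>An antisymmetric bilinear form comparing positions by their order. It serves twice: for
  the heights of particles within one column, and for the horizontal order of sources and sinks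
  along the boundary.\<close>

definition sgn_pairing :: "int \<Rightarrow> (int \<Rightarrow> int) \<Rightarrow> (int \<Rightarrow> int) \<Rightarrow> int" where
  "sgn_pairing n f g = (\<Sum>x=-n..n. \<Sum>y=-n..n. sgn (x - y) * f x * g y)"

definition grid_sum :: "int \<Rightarrow> (int \<Rightarrow> int \<Rightarrow> int) \<Rightarrow> int" where
  "grid_sum n g = (\<Sum>x=-n..n. \<Sum>y=-n..n. g x y)"

text \<open>The support condition makes \<open>g\<close> vanish at \<open>-n\<close> and
  \<open>n + 1\<close>, the two points in which the ranges differ.\<close>

lemma sum_shift_left:
  fixes g :: "int \<Rightarrow> 'a::comm_monoid_add"
  assumes "\<And>y. g y \<noteq> 0 \<Longrightarrow> -n < y \<and> y \<le> n"
  shows "(\<Sum>y=-n..n. g (y + 1)) = (\<Sum>y=-n..n. g y)"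
  by (rule sum.reindex_bij_witness_not_neutral
      [where S' = "{y. y \<in> {-n..n} \<and> g (y+1) = 0}" and T' = "{y. y \<in> {-n..n} \<and> g y = 0}"
        and i = "\<lambda>y. y - 1" and j = "\<lambda>y. y + 1"])
    (auto dest: assms intro: finite_subset[of _ "{-n..n}"])

lemma sum_shift_right:
  fixes g :: "int \<Rightarrow> 'a::comm_monoid_add"
  assumes "\<And>y. g y \<noteq> 0 \<Longrightarrow> -n \<le> y \<and> y < n"
  shows "(\<Sum>y=-n..n. g (y - 1)) = (\<Sum>y=-n..n. g y)"
  by (rule sum.reindex_bij_witness_not_neutral
      [where S' = "{y. y \<in> {-n..n} \<and> g (y-1) = 0}" and T' = "{y. y \<in> {-n..n} \<and> g y = 0}"
        and i = "\<lambda>y. y + 1" and j = "\<lambda>y. y - 1"])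
    (auto dest: assms intro: finite_subset[of _ "{-n..n}"])

lemma grid_sum_add: "grid_sum n (\<lambda>x y. f x y + g x y) = grid_sum n f + grid_sum n g"
  by (simp add: grid_sum_def sum.distrib)

lemma grid_sum_diff: "grid_sum n (\<lambda>x y. f x y - g x y) = grid_sum n f - grid_sum n g"
  by (simp add: grid_sum_def sum_subtractf)

lemma grid_sum_cmult: "grid_sum n (\<lambda>x y. c * f x y) = c * grid_sum n f"
  by (simp add: grid_sum_def sum_distrib_left)

lemma grid_sum_shift:
  assumes "\<And>x y. g x y \<noteq> 0 \<Longrightarrow> -n < x \<and> x < n \<and> -n < y \<and> y < n"
  shows "grid_sum n (\<lambda>x y. g (x + 1) y) = grid_sum n g" "grid_sum n (\<lambda>x y. g (x - 1) y) = grid_sum n g"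
    "grid_sum n (\<lambda>x y. g x (y + 1)) = grid_sum n g" "grid_sum n (\<lambda>x y. g x (y - 1)) = grid_sum n g"
proof -
  have nz: "-n < x \<and> x < n" if "(\<Sum>y=-n..n. g x y) \<noteq> 0" for x
    using that assms by (metis sum.neutral)
  show "grid_sum n (\<lambda>x y. g (x + 1) y) = grid_sum n g"
    unfolding grid_sum_def by (rule sum_shift_left) (use nz in fastforce)
  show "grid_sum n (\<lambda>x y. g (x - 1) y) = grid_sum n g"
    unfolding grid_sum_def by (rule sum_shift_right) (use nz in fastforce)
  show "grid_sum n (\<lambda>x y. g x (y + 1)) = grid_sum n g"
    unfolding grid_sum_def by (intro sum.cong refl sum_shift_left) (use assms in fastforce)
  show "grid_sum n (\<lambda>x y. g x (y - 1)) = grid_sum n g"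
    unfolding grid_sum_def by (intro sum.cong refl sum_shift_right) (use assms in fastforce)
qed

text \<open>Summation by parts: when \<open>y\<close> grows by one, \<open>sgn (y - z)\<close>
  increases by 1 at the steps starting in \<open>z - 1\<close> and in \<open>z\<close>, and is
  constant otherwise.\<close>

lemma sum_sgn_gradient:
  fixes j :: "int \<Rightarrow> int"
  assumes supp: "\<And>y. j y \<noteq> 0 \<Longrightarrow> -n \<le> y \<and> y < n" and z: "-n \<le> z" "z \<le> n"
  shows "(\<Sum>y=-n..n. sgn (y - z) * (j (y - 1) - j y)) = j z + j (z - 1)"
proof -
  have "(\<Sum>y=-n..n. sgn (y - z) * j (y - 1)) = (\<Sum>y=-n..n. sgn ((y - 1) + 1 - z) * j (y - 1))"
    by simp
  also have "\<dots> = (\<Sum>y=-n..n. sgn (y + 1 - z) * j y)"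
    by (rule sum_shift_right[where g = "\<lambda>y. sgn (y + 1 - z) * j y"]) (use supp in auto)
  finally have "(\<Sum>y=-n..n. sgn (y - z) * (j (y - 1) - j y))
      = (\<Sum>y=-n..n. sgn (y + 1 - z) * j y - sgn (y - z) * j y)"
    by (simp add: sum_subtractf algebra_simps)
  also have "\<dots> = (\<Sum>y=-n..n. (if y = z then j y else 0) + (if y = z - 1 then j y else 0))"
    by (rule sum.cong) (auto simp: sgn_if)
  also have "\<dots> = j z + j (z - 1)"
    \<comment> \<open>For \<open>z = -n\<close> the second delta lies outside the range, but then
      \<open>j (z - 1) = 0\<close> by the support condition.\<close>
    using z supp[of "z - 1"] by (auto simp: sum.distrib sum.delta)
  finally show ?thesis .
qed

section \<open>Algebra of the sign pairing\<close>

lemma sgn_pairing_add_left: "sgn_pairing n (\<lambda>x. f x + f' x) g = sgn_pairing n f g + sgn_pairing n f' g"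
  by (simp add: sgn_pairing_def sum.distrib algebra_simps)

lemma sgn_pairing_add_right: "sgn_pairing n f (\<lambda>x. g x + g' x) = sgn_pairing n f g + sgn_pairing n f g'"
  by (simp add: sgn_pairing_def sum.distrib algebra_simps)

lemma sgn_pairing_diff_left: "sgn_pairing n (\<lambda>x. f x - f' x) g = sgn_pairing n f g - sgn_pairing n f' g"
  by (simp add: sgn_pairing_def sum_subtractf algebra_simps)

lemma sgn_pairing_diff_right: "sgn_pairing n f (\<lambda>x. g x - g' x) = sgn_pairing n f g - sgn_pairing n f g'"
  by (simp add: sgn_pairing_def sum_subtractf algebra_simps)

lemma sgn_pairing_swap: "sgn_pairing n f g = - sgn_pairing n g f"
proof -
  have "sgn_pairing n f g = (\<Sum>y=-n..n. \<Sum>x=-n..n. sgn (x - y) * f x * g y)"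
    unfolding sgn_pairing_def by (rule sum.swap)
  also have "\<dots> = (\<Sum>y=-n..n. \<Sum>x=-n..n. - (sgn (y - x) * g y * f x))"
    by (intro sum.cong refl) (simp add: sgn_if)
  finally show ?thesis by (simp add: sgn_pairing_def sum_negf)
qed

lemma sgn_pairing_gradient_left:
  assumes "\<And>y. j y \<noteq> 0 \<Longrightarrow> -n \<le> y \<and> y < n"
  shows "sgn_pairing n (\<lambda>y. j (y - 1) - j y) g = (\<Sum>y=-n..n. (j y + j (y - 1)) * g y)"
proof -
  have "sgn_pairing n (\<lambda>y. j (y - 1) - j y) g
      = (\<Sum>z=-n..n. (\<Sum>y=-n..n. sgn (y - z) * (j (y - 1) - j y)) * g z)"
    unfolding sgn_pairing_def by (subst sum.swap) (simp add: sum_distrib_right)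
  also have "\<dots> = (\<Sum>z=-n..n. (j z + j (z - 1)) * g z)"
    by (intro sum.cong refl) (simp add: sum_sgn_gradient[OF assms])
  finally show ?thesis .
qed

text \<open>No point of the support of \<open>g\<close> lies above one of \<open>f\<close>, so the
  sign is 1 for all relevant pairs except on the diagonal, where it is 0; the last sum corrects for
  that.\<close>

lemma sgn_pairing_top:
  assumes "\<And>x y. f x \<noteq> 0 \<Longrightarrow> x < y \<Longrightarrow> g y = 0"
  shows "sgn_pairing n f g = (\<Sum>x=-n..n. f x) * (\<Sum>x=-n..n. g x) - (\<Sum>x=-n..n. f x * g x)"
proof -
  have "sgn (x - y) * f x * g y = f x * g y - (if x = y then f x * g y else 0)" for x y
    using assms[of x y] by (auto simp: sgn_if)
  then show ?thesis
    by (simp add: sgn_pairing_def sum_subtractf sum_product sum.delta)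
qed

lemma sgn_pairing_bottom:
  assumes "\<And>x y. f x \<noteq> 0 \<Longrightarrow> y < x \<Longrightarrow> g y = 0"
  shows "sgn_pairing n f g = (\<Sum>x=-n..n. f x * g x) - (\<Sum>x=-n..n. f x) * (\<Sum>x=-n..n. g x)"
proof -
  have "sgn (x - y) * f x * g y = (if x = y then f x * g y else 0) - f x * g y" for x y
    using assms[of x y] by (auto simp: sgn_if)
  then show ?thesis
    by (simp add: sgn_pairing_def sum_subtractf sum_product sum.delta)
qed

section \<open>Two coloured currents on the square lattice\<close>

text \<open>\<open>l\<close>, \<open>r\<close>, \<open>u\<close>, \<open>d\<close> stand for the
  indicators of the edge leaving (x, y) in the respective direction. In the sweep, the particle on
  the link to the right of a vertex leaves along the outgoing edge (\<open>out_bal\<close>), and the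
  particle on the link to the left, which has the other colour, arrives along the incoming edge
  (\<open>in_bal\<close>); an edge directed to the right means that there is no particle.
  \<open>sink\<close> and \<open>src\<close> record the defects of these two rules.\<close>

locale lattice_flow =
  fixes n :: int and V :: "int \<Rightarrow> int \<Rightarrow> bool"
    and l r u d sink src :: "int \<Rightarrow> int \<Rightarrow> int"
  assumes V_bound: "V x y \<Longrightarrow> -n < x \<and> x < n \<and> -n < y \<and> y < n"
    and l_V: "l x y \<noteq> 0 \<Longrightarrow> V x y \<and> V (x - 1) y"
    and r_V: "r x y \<noteq> 0 \<Longrightarrow> V x y \<and> V (x + 1) y"
    and u_V: "u x y \<noteq> 0 \<Longrightarrow> V x y \<and> V x (y + 1)"
    and d_V: "d x y \<noteq> 0 \<Longrightarrow> V x y \<and> V x (y - 1)"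
    and out_bal: "l x y + r x y + u x y + d x y + sink x y = of_bool (V x y \<and> V (x + 1) y)"
    and in_bal: "l (x + 1) y + r (x - 1) y + u x (y - 1) + d x (y + 1) + src x y
                  = of_bool (V x y \<and> V (x - 1) y)"
    and lr: "l x y * r (x - 1) y = 0"
    and ud: "u x y * d x (y + 1) = 0"
    and sink_src: "sink x y * src x y = 0"
    and top: "even (x + y) \<Longrightarrow> sink x y \<noteq> 0 \<or> src x y \<noteq> 0 \<Longrightarrow> y < y' \<Longrightarrow> \<not> V x y'"
    and bottom: "odd (x + y) \<Longrightarrow> sink x y \<noteq> 0 \<or> src x y \<noteq> 0 \<Longrightarrow> y' < y \<Longrightarrow> \<not> V x y'"
begin

text \<open>Both balances count the links, once by left and once by right end. An edge is weighted
  by \<open>\<phi>\<close> at its tail as outgoing edge and by \<open>\<phi>\<close> one column left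
  of its head as incoming edge; for an edge directed to the right these agree, so \<open>r\<close>
  drops out.\<close>

lemma weighted_balance:
  fixes \<phi> :: "int \<Rightarrow> int \<Rightarrow> int"
  shows "grid_sum n (\<lambda>x y. \<phi> x y * sink x y) - grid_sum n (\<lambda>x y. \<phi> (x - 1) y * src x y)
    = grid_sum n (\<lambda>x y. (\<phi> (x - 2) y - \<phi> x y) * l x y + (\<phi> (x - 1) (y + 1) - \<phi> x y) * u x y
                  + (\<phi> (x - 1) (y - 1) - \<phi> x y) * d x y)"
proof -
  have 1: "grid_sum n (\<lambda>x y. \<phi> (x - 1) y * l (x + 1) y) = grid_sum n (\<lambda>x y. \<phi> (x - 2) y * l x y)"
    using grid_sum_shift(1)[of "\<lambda>x y. \<phi> (x - 2) y * l x y" n] l_V V_bound by fastforce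
  have 2: "grid_sum n (\<lambda>x y. \<phi> (x - 1) y * r (x - 1) y) = grid_sum n (\<lambda>x y. \<phi> x y * r x y)"
    using grid_sum_shift(2)[of "\<lambda>x y. \<phi> x y * r x y" n] r_V V_bound by fastforce
  have 3: "grid_sum n (\<lambda>x y. \<phi> (x - 1) y * u x (y - 1)) = grid_sum n (\<lambda>x y. \<phi> (x - 1) (y + 1) * u x y)"
    using grid_sum_shift(4)[of "\<lambda>x y. \<phi> (x - 1) (y + 1) * u x y" n] u_V V_bound by fastforce
  have 4: "grid_sum n (\<lambda>x y. \<phi> (x - 1) y * d x (y + 1)) = grid_sum n (\<lambda>x y. \<phi> (x - 1) (y - 1) * d x y)"
    using grid_sum_shift(3)[of "\<lambda>x y. \<phi> (x - 1) (y - 1) * d x y" n] d_V V_bound by fastforce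
  have "grid_sum n (\<lambda>x y. \<phi> (x - 1) y * of_bool (V x y \<and> V (x - 1) y))
      = grid_sum n (\<lambda>x y. \<phi> x y * of_bool (V x y \<and> V (x + 1) y))"
    using grid_sum_shift(2)[of "\<lambda>x y. \<phi> x y * of_bool (V x y \<and> V (x + 1) y)" n] V_bound
    by (fastforce simp: conj_commute)
  then have "grid_sum n (\<lambda>x y. \<phi> (x - 1) y * (l (x + 1) y + r (x - 1) y + u x (y - 1) + d x (y + 1) + src x y))
      = grid_sum n (\<lambda>x y. \<phi> x y * (l x y + r x y + u x y + d x y + sink x y))"
    by (simp only: in_bal out_bal)
  then show ?thesis
    using 1 2 3 4 by (simp add: ring_distribs grid_sum_add grid_sum_diff)
qed

text \<open>
  The numbers of blue and red particles on the link to the right of (x, y), skipping particles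
  included, and the upward currents of particles across the edge from (x, y) to (x, y + 1).
\<close>

definition nB :: "int \<Rightarrow> int \<Rightarrow> int" where
  "nB x y = (if even (x + y) then of_bool (V x y \<and> V (x + 1) y) - r x y else l (x + 1) y)"

definition nR :: "int \<Rightarrow> int \<Rightarrow> int" where
  "nR x y = (if even (x + y) then l (x + 1) y else of_bool (V x y \<and> V (x + 1) y) - r x y)"

definition jB :: "int \<Rightarrow> int \<Rightarrow> int" where
  "jB x y = (if even (x + y) then u x y else - d x (y + 1))"

definition jR :: "int \<Rightarrow> int \<Rightarrow> int" where
  "jR x y = (if even (x + y) then - d x (y + 1) else u x y)"

text \<open>A sink absorbs the particle on the link to the right of its vertex, a source feeds the
  link to the left. These links have different colours, hence the exchanged parities.\<close>

definition bsink :: "int \<Rightarrow> int \<Rightarrow> int" where "bsink x y = (if even (x + y) then sink x y else 0)"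
definition bsrc :: "int \<Rightarrow> int \<Rightarrow> int" where "bsrc x y = (if even (x + y) then 0 else src x y)"
definition rsink :: "int \<Rightarrow> int \<Rightarrow> int" where "rsink x y = (if even (x + y) then 0 else sink x y)"
definition rsrc :: "int \<Rightarrow> int \<Rightarrow> int" where "rsrc x y = (if even (x + y) then src x y else 0)"

abbreviation col :: "(int \<Rightarrow> int \<Rightarrow> int) \<Rightarrow> int \<Rightarrow> int" where
  "col g x \<equiv> \<Sum>y=-n..n. g x y"

section \<open>Evolution of the particles from column to column\<close>

lemma nB_V: "nB x y \<noteq> 0 \<Longrightarrow> V x y \<and> V (x + 1) y"
  using r_V[of x y] l_V[of "x+1" y]
  by (cases "V x y \<and> V (x + 1) y") (auto simp: nB_def split: if_splits)

lemma nR_V: "nR x y \<noteq> 0 \<Longrightarrow> V x y \<and> V (x + 1) y"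
  using r_V[of x y] l_V[of "x+1" y]
  by (cases "V x y \<and> V (x + 1) y") (auto simp: nR_def split: if_splits)

lemma jB_V: "jB x y \<noteq> 0 \<Longrightarrow> V x y \<and> V x (y + 1)"
  using u_V[of x y] d_V[of x "y+1"] by (auto simp: jB_def split: if_splits)

lemma jR_V: "jR x y \<noteq> 0 \<Longrightarrow> V x y \<and> V x (y + 1)"
  using u_V[of x y] d_V[of x "y+1"] by (auto simp: jR_def split: if_splits)

text \<open>This is \<open>out_bal\<close> at an odd vertex and \<open>in_bal\<close> at an even
  one. Writing the vertical moves as a difference of currents makes
  \<open>sgn_pairing_gradient_left\<close> applicable.\<close>

lemma nB_step: "nB (x - 1) y = nB x y + (jB x (y - 1) - jB x y) - bsink x y + bsrc x y"
  using out_bal[of x y] in_bal[of x y]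
  by (auto simp: nB_def jB_def bsink_def bsrc_def conj_commute)

lemma nR_step: "nR (x - 1) y = nR x y + (jR x (y - 1) - jR x y) - rsink x y + rsrc x y"
  using out_bal[of x y] in_bal[of x y]
  by (auto simp: nR_def jR_def rsink_def rsrc_def conj_commute)

lemma jB_supp: "jB x y \<noteq> 0 \<Longrightarrow> -n \<le> y \<and> y < n"
  using jB_V V_bound by (metis less_imp_le)

lemma jR_supp: "jR x y \<noteq> 0 \<Longrightarrow> -n \<le> y \<and> y < n"
  using jR_V V_bound by (metis less_imp_le)

lemma col_nB_step: "col nB x - col nB (x - 1) = col bsink x - col bsrc x"
proof -
  have "(\<Sum>y=-n..n. jB x (y - 1)) = col jB x"
    by (rule sum_shift_right) (use jB_supp in blast)
  then show ?thesis by (simp add: nB_step sum.distrib sum_subtractf)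
qed

lemma col_nR_step: "col nR x - col nR (x - 1) = col rsink x - col rsrc x"
proof -
  have "(\<Sum>y=-n..n. jR x (y - 1)) = col jR x"
    by (rule sum_shift_right) (use jR_supp in blast)
  then show ?thesis by (simp add: nR_step sum.distrib sum_subtractf)
qed

lemma col_supp:
  assumes "\<And>x y. g x y \<noteq> 0 \<Longrightarrow> V x y"
  shows "col g x \<noteq> 0 \<Longrightarrow> -n < x \<and> x < n"
  using assms V_bound by (metis sum.neutral)

text \<open>The local part of twice the change of the blue-red pairing between the columns
  \<open>x\<close> and \<open>x - 1\<close>: vertical currents of one colour against particles of
  the other at the same height, and the defects of sources and sinks.\<close>

definition turn :: "int \<Rightarrow> int \<Rightarrow> int" where
  "turn x y =
    (jB x y + jB x (y - 1)) * (nR x y + nR (x - 1) y)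
    - (jR x y + jR x (y - 1)) * (nB x y + nB (x - 1) y)
    + (bsink x y + bsrc x y) * (nR x y + nR (x - 1) y)
    + (rsink x y + rsrc x y) * (nB x y + nB (x - 1) y)"

text \<open>
  Sources and sinks are extremal in their column, so that pairing with one of them merely counts
  the particles of the column; the defect of this at equal height enters turn.
\<close>

lemma column_step:
  "2 * (sgn_pairing n (nB (x - 1)) (nR (x - 1)) - sgn_pairing n (nB x) (nR x))
   = col turn x - (col bsink x + col bsrc x) * (col nR x + col nR (x - 1))
       - (col rsink x + col rsrc x) * (col nB x + col nB (x - 1))"
proof -
  define R where "R = (\<lambda>y. nR x y + nR (x - 1) y)"
  define B where "B = (\<lambda>y. nB x y + nB (x - 1) y)"
  have R0: "R y = 0" if "\<not> V x y" for y
  proof -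
    have "nR x y = 0" "nR (x - 1) y = 0"
      using that nR_V[of x y] nR_V[of "x - 1" y] by auto
    then show ?thesis by (simp add: R_def)
  qed
  have B0: "B y = 0" if "\<not> V x y" for y
  proof -
    have "nB x y = 0" "nB (x - 1) y = 0"
      using that nB_V[of x y] nB_V[of "x - 1" y] by auto
    then show ?thesis by (simp add: B_def)
  qed
  have s1: "sgn_pairing n (bsink x) R = col bsink x * (\<Sum>y=-n..n. R y) - (\<Sum>y=-n..n. bsink x y * R y)"
    by (rule sgn_pairing_top) (use top R0 in \<open>auto simp: bsink_def split: if_splits\<close>)
  have s2: "sgn_pairing n (bsrc x) R = (\<Sum>y=-n..n. bsrc x y * R y) - col bsrc x * (\<Sum>y=-n..n. R y)"
    by (rule sgn_pairing_bottom) (use bottom R0 in \<open>auto simp: bsrc_def split: if_splits\<close>)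
  have s3: "sgn_pairing n (rsrc x) B = col rsrc x * (\<Sum>y=-n..n. B y) - (\<Sum>y=-n..n. rsrc x y * B y)"
    by (rule sgn_pairing_top) (use top B0 in \<open>auto simp: rsrc_def split: if_splits\<close>)
  have s4: "sgn_pairing n (rsink x) B = (\<Sum>y=-n..n. rsink x y * B y) - col rsink x * (\<Sum>y=-n..n. B y)"
    by (rule sgn_pairing_bottom) (use bottom B0 in \<open>auto simp: rsink_def split: if_splits\<close>)
  have jb: "sgn_pairing n (\<lambda>y. jB x (y - 1) - jB x y) R = (\<Sum>y=-n..n. (jB x y + jB x (y - 1)) * R y)"
    by (rule sgn_pairing_gradient_left) (use jB_supp in blast)
  have jr: "sgn_pairing n (\<lambda>y. jR x (y - 1) - jR x y) B = (\<Sum>y=-n..n. (jR x y + jR x (y - 1)) * B y)"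
    by (rule sgn_pairing_gradient_left) (use jR_supp in blast)
  have dB: "(\<lambda>y. nB (x - 1) y - nB x y) = (\<lambda>y. (jB x (y - 1) - jB x y) - bsink x y + bsrc x y)"
    by (rule ext) (simp add: nB_step)
  have dR: "(\<lambda>y. nR (x - 1) y - nR x y) = (\<lambda>y. (jR x (y - 1) - jR x y) - rsink x y + rsrc x y)"
    by (rule ext) (simp add: nR_step)
  \<comment> \<open>Product rule for the bilinear form, symmetrised in the two columns; the mixed
    pairings cancel.\<close>
  have "2 * (sgn_pairing n (nB (x - 1)) (nR (x - 1)) - sgn_pairing n (nB x) (nR x))
      = sgn_pairing n (\<lambda>y. nB (x - 1) y - nB x y) R + sgn_pairing n B (\<lambda>y. nR (x - 1) y - nR x y)"
    by (simp add: R_def B_def sgn_pairing_add_left sgn_pairing_add_right sgn_pairing_diff_left sgn_pairing_diff_right)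
  also have "sgn_pairing n B (\<lambda>y. nR (x - 1) y - nR x y) = - sgn_pairing n (\<lambda>y. nR (x - 1) y - nR x y) B"
    by (rule sgn_pairing_swap)
  also have "sgn_pairing n (\<lambda>y. nB (x - 1) y - nB x y) R
      = sgn_pairing n (\<lambda>y. jB x (y - 1) - jB x y) R - sgn_pairing n (bsink x) R + sgn_pairing n (bsrc x) R"
    unfolding dB by (simp only: sgn_pairing_add_left sgn_pairing_diff_left[of n "\<lambda>y. jB x (y - 1) - jB x y"])
  also have "sgn_pairing n (\<lambda>y. nR (x - 1) y - nR x y) B
      = sgn_pairing n (\<lambda>y. jR x (y - 1) - jR x y) B - sgn_pairing n (rsink x) B + sgn_pairing n (rsrc x) B"
    unfolding dR by (simp only: sgn_pairing_add_left sgn_pairing_diff_left[of n "\<lambda>y. jR x (y - 1) - jR x y"])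
  finally have *: "2 * (sgn_pairing n (nB (x - 1)) (nR (x - 1)) - sgn_pairing n (nB x) (nR x))
     = (\<Sum>y=-n..n. (jB x y + jB x (y - 1)) * R y) - (\<Sum>y=-n..n. (jR x y + jR x (y - 1)) * B y)
       + (\<Sum>y=-n..n. bsink x y * R y) + (\<Sum>y=-n..n. bsrc x y * R y)
       + (\<Sum>y=-n..n. rsink x y * B y) + (\<Sum>y=-n..n. rsrc x y * B y)
       - (col bsink x + col bsrc x) * (\<Sum>y=-n..n. R y)
       - (col rsink x + col rsrc x) * (\<Sum>y=-n..n. B y)"
    by (simp add: s1 s2 s3 s4 jb jr algebra_simps)
  have t: "col turn x = (\<Sum>y=-n..n. (jB x y + jB x (y - 1)) * R y)
       - (\<Sum>y=-n..n. (jR x y + jR x (y - 1)) * B y)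
       + (\<Sum>y=-n..n. bsink x y * R y) + (\<Sum>y=-n..n. bsrc x y * R y)
       + (\<Sum>y=-n..n. rsink x y * B y) + (\<Sum>y=-n..n. rsrc x y * B y)"
    by (simp add: turn_def R_def B_def sum.distrib[symmetric] sum_subtractf[symmetric] algebra_simps)
  have "(\<Sum>y=-n..n. R y) = col nR x + col nR (x - 1)" "(\<Sum>y=-n..n. B y) = col nB x + col nB (x - 1)"
    by (simp_all add: R_def B_def sum.distrib)
  then show ?thesis using * t by simp
qed

text \<open>Summed over all columns, \<open>column_step\<close> telescopes to 0 because no particles
  lie near the border of the box. The remaining products contain column totals whose increments are
  sources minus sinks, so summation by parts applies a second time, now horizontally.\<close>

lemma grid_sum_turn:
  "grid_sum n turn = 2 * (sgn_pairing n (col bsrc) (col rsink) - sgn_pairing n (col bsink) (col rsrc))"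
proof -
  have z: "nB x y = 0" "nR x y = 0" if "\<not> (-n < x \<and> x < n)" for x y
    using that nB_V nR_V V_bound by blast+
  have "(\<Sum>x=-n..n. sgn_pairing n (nB (x - 1)) (nR (x - 1))) = (\<Sum>x=-n..n. sgn_pairing n (nB x) (nR x))"
  proof (rule sum_shift_right)
    fix x assume "sgn_pairing n (nB x) (nR x) \<noteq> 0"
    then have "-n < x \<and> x < n" using z(1) by (force simp: sgn_pairing_def)
    then show "-n \<le> x \<and> x < n" by simp
  qed
  then have "(\<Sum>x=-n..n. 2 * (sgn_pairing n (nB (x - 1)) (nR (x - 1)) - sgn_pairing n (nB x) (nR x))) = 0"
    by (simp add: sum_subtractf sum_distrib_left[symmetric])
  then have eq: "grid_sum n turn =
       (\<Sum>x=-n..n. (col nR x + col nR (x - 1)) * (col bsink x + col bsrc x))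
     + (\<Sum>x=-n..n. (col nB x + col nB (x - 1)) * (col rsink x + col rsrc x))"
    by (simp only: column_step) (simp add: grid_sum_def sum_subtractf mult.commute)
  have "(\<Sum>x=-n..n. (col nR x + col nR (x - 1)) * (col bsink x + col bsrc x))
      = sgn_pairing n (\<lambda>x. col nR (x - 1) - col nR x) (\<lambda>x. col bsink x + col bsrc x)"
    by (rule sgn_pairing_gradient_left[symmetric])
       (use nR_V col_supp[of nR] in \<open>metis less_imp_le\<close>)
  also have "(\<lambda>x. col nR (x - 1) - col nR x) = (\<lambda>x. col rsrc x - col rsink x)"
    by (rule ext) (use col_nR_step in \<open>smt (verit)\<close>)
  finally have 1: "(\<Sum>x=-n..n. (col nR x + col nR (x - 1)) * (col bsink x + col bsrc x))
      = sgn_pairing n (\<lambda>x. col rsrc x - col rsink x) (\<lambda>x. col bsink x + col bsrc x)" .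
  have "(\<Sum>x=-n..n. (col nB x + col nB (x - 1)) * (col rsink x + col rsrc x))
      = sgn_pairing n (\<lambda>x. col nB (x - 1) - col nB x) (\<lambda>x. col rsink x + col rsrc x)"
    by (rule sgn_pairing_gradient_left[symmetric])
       (use nB_V col_supp[of nB] in \<open>metis less_imp_le\<close>)
  also have "(\<lambda>x. col nB (x - 1) - col nB x) = (\<lambda>x. col bsrc x - col bsink x)"
    by (rule ext) (use col_nB_step in \<open>smt (verit)\<close>)
  finally have 2: "(\<Sum>x=-n..n. (col nB x + col nB (x - 1)) * (col rsink x + col rsrc x))
      = sgn_pairing n (\<lambda>x. col bsrc x - col bsink x) (\<lambda>x. col rsink x + col rsrc x)" .
  \<comment> \<open>By antisymmetry the source-source and sink-sink pairings cancel, while the mixed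
    ones double.\<close>
  show ?thesis
    using sgn_pairing_swap[of n "col rsrc" "col bsink"] sgn_pairing_swap[of n "col rsink" "col bsink"]
      sgn_pairing_swap[of n "col rsrc" "col bsrc"] sgn_pairing_swap[of n "col rsink" "col bsrc"]
    unfolding eq 1 2
    by (simp add: sgn_pairing_add_right sgn_pairing_diff_left)
qed

text \<open>The eight local configurations collected at single vertices: a vertical edge at its
  tail, a pair of consecutive edges at its middle vertex.\<close>

definition weight :: "int \<Rightarrow> int \<Rightarrow> int" where
  "weight x y = l (x + 1) y * l x y +
    (if even (x + y) then d x y + l (x + 1) y * d x y + u x (y - 1) * l x y
     else u x y + l (x + 1) y * u x y + d x (y + 1) * l x y)"

text \<open>All relations at one vertex become polynomial equations in the ten quantities around it,
  from which the claim follows algebraically. An edge directed to the left is shared equally by its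
  tail and its head, whence the two terms with factor 2.\<close>

lemma weight_local:
  "4 * weight x y =
     4 * (if even (x + y) then d x y else u x y) + 2 * l x y + 2 * l (x + 1) y - turn x y"
proof -
  define ol where "ol = l x y"
  define or' where "or' = r x y"
  define ou where "ou = u x y"
  define od where "od = d x y"
  define il where "il = l (x + 1) y"
  define ir where "ir = r (x - 1) y"
  define iu where "iu = u x (y - 1)"
  define id' where "id' = d x (y + 1)"
  define S where "S = sink x y"
  define E where "E = src x y"
  note defs = ol_def or'_def ou_def od_def il_def ir_def iu_def id'_def S_def E_def
  have o: "of_bool (V x y \<and> V (x + 1) y) = ol + or' + ou + od + S"
    using out_bal[of x y] by (simp add: defs)
  have i: "of_bool (V (x - 1) y \<and> V x y) = il + ir + iu + id' + E"
    using in_bal[of x y] by (simp add: defs conj_commute)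
  \<comment> \<open>An edge arriving from the right presupposes the link to the right, so the
    outgoing balance is 1 there; symmetrically for \<open>ol\<close> and the link to the
    left.\<close>
  have 1: "il * (ol + or' + ou + od + S) = il"
    using l_V[of "x + 1" y] unfolding o[symmetric] by (auto simp: il_def)
  have 2: "ol * (il + ir + iu + id' + E) = ol"
    using l_V[of x y] unfolding i[symmetric] by (auto simp: ol_def)
  have 3: "il * or' = 0" using lr[of "x + 1" y] by (simp add: defs)
  have 4: "ol * ir = 0" using lr[of x y] by (simp add: defs)
  have 5: "ou * id' = 0" using ud[of x y] by (simp add: defs)
  have 6: "od * iu = 0" using ud[of x "y - 1"] by (auto simp: defs)
  have 7: "S * E = 0" using sink_src by (simp add: defs)
  show ?thesis
  proof (cases "even (x + y)")
    case True
    \<comment> \<open>A sink or source at an odd vertex is topmost in its column, which excludes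
      edges to and from the vertex above.\<close>
    have z: "S * ou = 0" "S * id' = 0" "E * ou = 0" "E * id' = 0"
      using top[OF True, of "y + 1"] u_V[of x y] d_V[of x "y + 1"] by (auto simp: defs)
    have "weight x y = il * ol + od + il * od + iu * ol"
      using True by (simp add: weight_def defs)
    moreover have "turn x y = (ou - od) * (2 * il + iu + id' + E)
        - (iu - id') * (2 * ol + ou + od + S) + S * (2 * il + iu + id' + E)
        + E * (2 * ol + ou + od + S)"
      using True
      by (simp add: turn_def nB_def nR_def jB_def jR_def bsink_def bsrc_def rsink_def rsrc_def o i
          flip: defs; simp add: algebra_simps)
    ultimately have "4 * weight x y = 4 * od + 2 * ol + 2 * il - turn x y"
      using 1 2 3 4 5 6 7 z by algebra
    then show ?thesis using True by (simp add: defs)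
  next
    case False
    have z: "S * od = 0" "S * iu = 0" "E * od = 0" "E * iu = 0"
      using bottom[OF False, of "y - 1"] d_V[of x y] u_V[of x "y - 1"] by (auto simp: defs)
    have "weight x y = il * ol + ou + il * ou + id' * ol"
      using False by (simp add: weight_def defs)
    moreover have "turn x y = (iu - id') * (2 * ol + ou + od + S)
        - (ou - od) * (2 * il + iu + id' + E) + E * (2 * ol + ou + od + S)
        + S * (2 * il + iu + id' + E)"
      using False
      by (simp add: turn_def nB_def nR_def jB_def jR_def bsink_def bsrc_def rsink_def rsrc_def o i
          flip: defs; simp add: algebra_simps)
    ultimately have "4 * weight x y = 4 * ou + 2 * ol + 2 * il - turn x y"
      using 1 2 3 4 5 6 7 z by algebra
    then show ?thesis using False by (simp add: defs)
  qed
qed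

text \<open>Combines the two conservation arguments: \<open>weight_local\<close> reduces the count
  to vertical and left edges, evaluated by potentials, and to crossings, evaluated by
  \<open>grid_sum_turn\<close>.\<close>

theorem grid_sum_weight:
  "2 * grid_sum n weight =
     grid_sum n (\<lambda>x y. (x + y - 1) * bsrc x y) - grid_sum n (\<lambda>x y. (x + y) * bsink x y)
   + grid_sum n (\<lambda>x y. (x - y - 1) * rsrc x y) - grid_sum n (\<lambda>x y. (x - y) * rsink x y)
   - sgn_pairing n (col bsrc) (col rsink) + sgn_pairing n (col bsink) (col rsrc)"
proof -
  let ?v = "\<lambda>x y. if even (x + y) then d x y else u x y"
  have "grid_sum n (\<lambda>x y. l (x + 1) y) = grid_sum n l"
    by (rule grid_sum_shift) (use l_V V_bound in blast)
  then have A: "4 * grid_sum n weight = 4 * grid_sum n ?v + 4 * grid_sum n l - grid_sum n turn"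
    using arg_cong[OF ext[OF ext[OF weight_local]], of "grid_sum n"]
    by (simp add: grid_sum_cmult grid_sum_add grid_sum_diff)
  \<comment> \<open>Moves include the shift by the sweep. The blue potential \<open>x + y\<close>
    drops by 2 for an edge to the left or downwards and is unchanged for one upwards; the red
    potential \<open>x - y\<close> drops by 2 for an edge to the left or upwards and is unchanged
    for one downwards. Together these are exactly the edges counted by \<open>?v\<close> and
    \<open>l\<close>.\<close>
  let ?p = "\<lambda>x y. if even (x + y) then x + y else (0::int)"
  let ?q = "\<lambda>x y. if even (x + y) then 0 else (x - y::int)"
  have b: "grid_sum n (\<lambda>x y. (x + y) * bsink x y) - grid_sum n (\<lambda>x y. (x + y - 1) * bsrc x y)
      = grid_sum n (\<lambda>x y. (?p (x - 2) y - ?p x y) * l x y + (?p (x - 1) (y + 1) - ?p x y) * u x y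
                  + (?p (x - 1) (y - 1) - ?p x y) * d x y)"
    unfolding weighted_balance[of ?p, symmetric]
    by (intro arg_cong2[where f = minus] arg_cong[where f = "grid_sum n"] ext)
       (auto simp: bsink_def bsrc_def algebra_simps)
  have r: "grid_sum n (\<lambda>x y. (x - y) * rsink x y) - grid_sum n (\<lambda>x y. (x - y - 1) * rsrc x y)
      = grid_sum n (\<lambda>x y. (?q (x - 2) y - ?q x y) * l x y + (?q (x - 1) (y + 1) - ?q x y) * u x y
                  + (?q (x - 1) (y - 1) - ?q x y) * d x y)"
    unfolding weighted_balance[of ?q, symmetric]
    by (intro arg_cong2[where f = minus] arg_cong[where f = "grid_sum n"] ext)
       (auto simp: rsink_def rsrc_def algebra_simps)
  have "grid_sum n (\<lambda>x y. (x + y) * bsink x y) - grid_sum n (\<lambda>x y. (x + y - 1) * bsrc x y)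
      + (grid_sum n (\<lambda>x y. (x - y) * rsink x y) - grid_sum n (\<lambda>x y. (x - y - 1) * rsrc x y))
      = grid_sum n (\<lambda>x y. - 2 * (?v x y + l x y))"
    unfolding b r grid_sum_add[symmetric]
    by (intro arg_cong[where f = "grid_sum n"] ext) (auto simp: algebra_simps)
  also have "\<dots> = - 2 * (grid_sum n ?v + grid_sum n l)"
    by (simp only: grid_sum_cmult grid_sum_add)
  finally show ?thesis using A grid_sum_turn by simp
qed

text \<open>Conservation of blue particles: no move changes the potential that is 1 on odd and 0 on
  even vertices.\<close>

lemma grid_sum_bsink_bsrc: "grid_sum n bsink = grid_sum n bsrc"
proof -
  let ?p = "\<lambda>x y. if even (x + y) then 1 else (0::int)"
  have "grid_sum n (\<lambda>x y. ?p x y * sink x y) - grid_sum n (\<lambda>x y. ?p (x - 1) y * src x y) = grid_sum n (\<lambda>x y. 0)"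
    unfolding weighted_balance[of ?p]
    by (intro arg_cong[where f = "grid_sum n"] ext) auto
  moreover have "(\<lambda>x y. ?p x y * sink x y) = bsink" "(\<lambda>x y. ?p (x - 1) y * src x y) = bsrc"
    by (auto simp: bsink_def bsrc_def fun_eq_iff)
  moreover have "grid_sum n (\<lambda>x y. 0) = 0" by (simp add: grid_sum_def)
  ultimately show ?thesis by simp
qed

lemma grid_sum_rsink_rsrc: "grid_sum n rsink = grid_sum n rsrc"
proof -
  let ?p = "\<lambda>x y. if even (x + y) then 0 else (1::int)"
  have "grid_sum n (\<lambda>x y. ?p x y * sink x y) - grid_sum n (\<lambda>x y. ?p (x - 1) y * src x y) = grid_sum n (\<lambda>x y. 0)"
    unfolding weighted_balance[of ?p]
    by (intro arg_cong[where f = "grid_sum n"] ext) auto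
  moreover have "(\<lambda>x y. ?p x y * sink x y) = rsink" "(\<lambda>x y. ?p (x - 1) y * src x y) = rsrc"
    by (auto simp: rsink_def rsrc_def fun_eq_iff)
  moreover have "grid_sum n (\<lambda>x y. 0) = 0" by (simp add: grid_sum_def)
  ultimately show ?thesis by simp
qed

end

section \<open>Grid sums as boundary sums and as cardinalities\<close>

lemma grid_sum_eq_sum:
  assumes "S \<subseteq> {-n..n} \<times> {-n..n}" "\<And>x y. g x y \<noteq> 0 \<Longrightarrow> (x, y) \<in> S"
  shows "grid_sum n g = (\<Sum>v\<in>S. g (fst v) (snd v))"
proof -
  have "grid_sum n g = (\<Sum>v\<in>{-n..n} \<times> {-n..n}. g (fst v) (snd v))"
    by (simp add: grid_sum_def sum.cartesian_product case_prod_beta)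
  also have "\<dots> = (\<Sum>v\<in>S. g (fst v) (snd v))"
  proof (rule sum.mono_neutral_right)
    show "\<forall>v\<in>{-n..n} \<times> {-n..n} - S. g (fst v) (snd v) = 0"
      using assms(2) by fastforce
  qed (use assms(1) in auto)
  finally show ?thesis .
qed

text \<open>Sinks and sources of a given colour are located on two families of distinguished
  vertices each.\<close>

lemma grid_sum_two_families:
  fixes a b :: "nat \<Rightarrow> vertex"
  assumes "inj a" "inj b" "\<And>x y. (x, y) \<in> a ` {1..p} \<Longrightarrow> (x, y) \<notin> b ` {1..q}"
    and "\<And>x y. (x, y) \<in> a ` {1..p} \<union> b ` {1..q} \<Longrightarrow> -n \<le> x \<and> x \<le> n \<and> -n \<le> y \<and> y \<le> n"
    and "\<And>x y. g x y \<noteq> 0 \<Longrightarrow> (x, y) \<in> a ` {1..p} \<union> b ` {1..q}"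
  shows "grid_sum n g = (\<Sum>i=1..p. g (fst (a i)) (snd (a i))) + (\<Sum>i=1..q. g (fst (b i)) (snd (b i)))"
proof -
  have "a ` {1..p} \<union> b ` {1..q} \<subseteq> {-n..n} \<times> {-n..n}"
    using assms(4) by (metis atLeastAtMost_iff mem_Sigma_iff subrelI)
  then have "grid_sum n g = (\<Sum>v\<in>a ` {1..p} \<union> b ` {1..q}. g (fst v) (snd v))"
    using assms(5) by (rule grid_sum_eq_sum)
  also have "\<dots> = (\<Sum>v\<in>a ` {1..p}. g (fst v) (snd v)) + (\<Sum>v\<in>b ` {1..q}. g (fst v) (snd v))"
    by (rule sum.union_disjoint) (use assms(3) in \<open>simp, simp, metis disjoint_iff surj_pair\<close>)
  also have "(\<Sum>v\<in>a ` {1..p}. g (fst v) (snd v)) = (\<Sum>i=1..p. g (fst (a i)) (snd (a i)))"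
    using assms(1) by (subst sum.reindex) (auto intro: inj_on_subset)
  also have "(\<Sum>v\<in>b ` {1..q}. g (fst v) (snd v)) = (\<Sum>i=1..q. g (fst (b i)) (snd (b i)))"
    using assms(2) by (subst sum.reindex) (auto intro: inj_on_subset)
  finally show ?thesis .
qed

text \<open>In this nested form the boundary formulas for sinks and sources can be applied to one
  argument after the other.\<close>

lemma sgn_pairing_columns:
  "sgn_pairing n (\<lambda>x. \<Sum>y=-n..n. f x y) (\<lambda>x. \<Sum>y=-n..n. g x y)
   = grid_sum n (\<lambda>x y. f x y * grid_sum n (\<lambda>x' y'. sgn (x - x') * g x' y'))"
proof -
  have "(\<Sum>x'=-n..n. sgn (x - x') * (\<Sum>y=-n..n. f x y) * (\<Sum>y=-n..n. g x' y))
      = (\<Sum>y=-n..n. f x y * grid_sum n (\<lambda>x' y'. sgn (x - x') * g x' y'))" for x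
    by (simp add: grid_sum_def sum_distrib_left[symmetric] sum_distrib_right[symmetric] ac_simps)
       (simp add: sum_distrib_left ac_simps)
  then show ?thesis by (simp add: sgn_pairing_def grid_sum_def)
qed

lemma card_eq_grid_sum:
  assumes "\<And>x y. (x, y) \<in> S \<Longrightarrow> -n \<le> x \<and> x \<le> n \<and> -n \<le> y \<and> y \<le> n"
  shows "int (card S) = grid_sum n (\<lambda>x y. of_bool ((x, y) \<in> S))"
proof -
  have S: "S \<subseteq> {-n..n} \<times> {-n..n}" using assms by auto
  then have "grid_sum n (\<lambda>x y. of_bool ((x, y) \<in> S)) = (\<Sum>v\<in>S. of_bool (v \<in> S))"
    using grid_sum_eq_sum[OF S, of "\<lambda>x y. of_bool ((x, y) \<in> S)"] by simp
  then show ?thesis by simp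
qed

lemma num_edges_eq:
  "num_edges D a P Q = card {u. (u, u + a) \<in> D \<and> P u \<and> Q (u + a)}"
proof -
  have "{(u, v). (u, v) \<in> D \<and> v - u = a \<and> P u \<and> Q v}
      = (\<lambda>u. (u, u + a)) ` {u. (u, u + a) \<in> D \<and> P u \<and> Q (u + a)}"
    by (auto simp: image_iff algebra_simps)
  then show ?thesis
    unfolding num_edges_def by (simp add: card_image inj_on_def)
qed

lemma num_turns_eq:
  "num_turns D a b P = card {v. (v - a, v) \<in> D \<and> (v, v + b) \<in> D \<and> P v}"
proof -
  have "{(u, v, w). (u, v) \<in> D \<and> (v, w) \<in> D \<and> v - u = a \<and> w - v = b \<and> P v}
      = (\<lambda>v. (v - a, v, v + b)) ` {v. (v - a, v) \<in> D \<and> (v, v + b) \<in> D \<and> P v}"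
  proof -
    have "v - u = a \<longleftrightarrow> u = v - a" "w - v = b \<longleftrightarrow> w = v + b" for u v w
      by (auto simp: algebra_simps)
    then show ?thesis by auto
  qed
  then show ?thesis
    unfolding num_turns_def by (simp add: card_image inj_on_def)
qed

section \<open>The currents of an oriented configuration\<close>

locale oriented_configuration =
  fixes K L M N :: nat and f :: "vertex set set" and D :: "(vertex \<times> vertex) set"
  assumes K_le: "K \<le> M + N" and N_le: "N \<le> K + L" and MN: "M + N \<ge> 1"
    and oriented: "oriented_hfpl K L M N f D"
begin

definition V :: "int \<Rightarrow> int \<Rightarrow> bool" where "V x y \<longleftrightarrow> (x, y) \<in> H_verts K L M N"
definition l :: "int \<Rightarrow> int \<Rightarrow> int" where "l x y = of_bool (((x, y), (x - 1, y)) \<in> D)"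
definition r :: "int \<Rightarrow> int \<Rightarrow> int" where "r x y = of_bool (((x, y), (x + 1, y)) \<in> D)"
definition u :: "int \<Rightarrow> int \<Rightarrow> int" where "u x y = of_bool (((x, y), (x, y + 1)) \<in> D)"
definition d :: "int \<Rightarrow> int \<Rightarrow> int" where "d x y = of_bool (((x, y), (x, y - 1)) \<in> D)"

text \<open>
  A sink misses an outgoing edge although there is a link to its right, a source misses an incoming
  edge although there is a link to its left.
\<close>

definition sink :: "int \<Rightarrow> int \<Rightarrow> int" where
  "sink x y = of_bool (V x y \<and> V (x + 1) y) - int (out_deg D (x, y))"

definition src :: "int \<Rightarrow> int \<Rightarrow> int" where
  "src x y = of_bool (V x y \<and> V (x - 1) y) - int (in_deg D (x, y))"

text \<open>A crude bound on all coordinates, with a margin so that the graph lies strictly inside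
  the box, as the shifts of grid sums require.\<close>

definition size_bound :: int where "size_bound = int (K + 2 * L + M + N + 3)"

lemma V_iff: "V x y \<longleftrightarrow> y \<le> x \<and> y \<le> int K - 1 \<and> y \<le> - x + 2 * (int K + int L) \<and>
     y \<ge> - x - 1 \<and> y \<ge> - int M - int N + int K \<and> y \<ge> x - 2 * (int M + int L) - 1"
  by (simp add: V_def H_verts_def)

lemma V_bound: "V x y \<Longrightarrow> - size_bound < x \<and> x < size_bound \<and> - size_bound < y \<and> y < size_bound"
  using K_le N_le by (auto simp: V_iff size_bound_def)

lemma D_f: "(p, q) \<in> D \<Longrightarrow> {p, q} \<in> f"
  using oriented unfolding oriented_hfpl_def orientation_def by blast

lemma D_antisym: "(p, q) \<in> D \<Longrightarrow> (q, p) \<notin> D"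
  using oriented D_f[of p q] unfolding oriented_hfpl_def orientation_def by blast

lemma f_edge: "{p, q} \<in> f \<Longrightarrow> p \<in> H_verts K L M N \<and> q \<in> H_verts K L M N \<and>
    \<bar>fst p - fst q\<bar> + \<bar>snd p - snd q\<bar> = 1"
proof -
  assume "{p, q} \<in> f"
  then have "{p, q} \<in> H_edges K L M N"
    using oriented by (auto simp: oriented_hfpl_def hfpl_def)
  then show ?thesis
    by (auto simp: H_edges_def doubleton_eq_iff abs_minus_commute)
qed

lemma D_edge: "((x, y), (x', y')) \<in> D \<Longrightarrow> V x y \<and> V x' y' \<and> \<bar>x - x'\<bar> + \<bar>y - y'\<bar> = 1"
  using f_edge[OF D_f[of "(x, y)" "(x', y')"]] by (simp add: V_def)

lemma neighbours: "\<bar>x - x'\<bar> + \<bar>y - y'\<bar> = (1::int) \<Longrightarrow>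
    (x', y') \<in> {(x - 1, y), (x + 1, y), (x, y + 1), (x, y - 1)}"
  by (auto simp: abs_if split: if_splits)

section \<open>Degrees in the oriented graph\<close>

lemma out_deg_eq: "int (out_deg D (x, y)) = l x y + r x y + u x y + d x y"
proof -
  have "v \<in> {(x - 1, y), (x + 1, y), (x, y + 1), (x, y - 1)}" if "((x, y), v) \<in> D" for v
    using that D_edge[of x y "fst v" "snd v"] neighbours[of x "fst v" y "snd v"]
    by (simp add: abs_minus_commute disj_ac)
  then have "{v. ((x, y), v) \<in> D}
      = {(x - 1, y), (x + 1, y), (x, y + 1), (x, y - 1)} \<inter> {v. ((x, y), v) \<in> D}"
    by blast
  then have "int (out_deg D (x, y))
      = (\<Sum>v\<in>{(x - 1, y), (x + 1, y), (x, y + 1), (x, y - 1)}. of_bool (((x, y), v) \<in> D))"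
    by (subst sum_of_bool_eq) (simp_all add: out_deg_def)
  then show ?thesis by (simp add: l_def r_def u_def d_def)
qed

lemma in_deg_eq: "int (in_deg D (x, y)) = l (x + 1) y + r (x - 1) y + u x (y - 1) + d x (y + 1)"
proof -
  have "v \<in> {(x + 1, y), (x - 1, y), (x, y - 1), (x, y + 1)}" if "(v, (x, y)) \<in> D" for v
    using that D_edge[of "fst v" "snd v" x y] neighbours[of x "fst v" y "snd v"]
    by (simp add: abs_minus_commute disj_ac)
  then have "{v. (v, (x, y)) \<in> D}
      = {(x + 1, y), (x - 1, y), (x, y - 1), (x, y + 1)} \<inter> {v. (v, (x, y)) \<in> D}"
    by blast
  then have "int (in_deg D (x, y))
      = (\<Sum>v\<in>{(x + 1, y), (x - 1, y), (x, y - 1), (x, y + 1)}. of_bool ((v, (x, y)) \<in> D))"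
    by (subst sum_of_bool_eq) (simp_all add: in_deg_def)
  then show ?thesis by (simp add: l_def r_def u_def d_def)
qed

text \<open>Each edge at \<open>v\<close> is oriented in exactly one way, so it corresponds to
  exactly one in-neighbour or out-neighbour; finiteness comes from the bounding box.\<close>

lemma degree_eq: "degree f v = in_deg D v + out_deg D v"
proof -
  have "w \<in> {-size_bound..size_bound} \<times> {-size_bound..size_bound}"
    if "(w, v) \<in> D \<or> (v, w) \<in> D" for w
    using that D_edge[of "fst w" "snd w" "fst v" "snd v"] D_edge[of "fst v" "snd v" "fst w" "snd w"]
      V_bound[of "fst w" "snd w"] by (auto simp: mem_Times_iff)
  then have "{w. (w, v) \<in> D} \<union> {w. (v, w) \<in> D}
      \<subseteq> {-size_bound..size_bound} \<times> {-size_bound..size_bound}"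
    by blast
  then have "finite ({w. (w, v) \<in> D} \<union> {w. (v, w) \<in> D})"
    by (rule finite_subset) simp
  then have fin: "finite {w. (w, v) \<in> D}" "finite {w. (v, w) \<in> D}"
    by simp_all
  have "{e \<in> f. v \<in> e} = (\<lambda>w. {v, w}) ` ({w. (w, v) \<in> D} \<union> {w. (v, w) \<in> D})"
  proof (intro set_eqI iffI)
    fix e assume e: "e \<in> {e \<in> f. v \<in> e}"
    then have "e \<in> H_edges K L M N"
      using oriented unfolding oriented_hfpl_def hfpl_def by blast
    then obtain p q where pq: "e = {p, q}"
      unfolding H_edges_def by blast
    have "e = {v, p} \<or> e = {v, q}" using e pq by blast
    then obtain w where w: "e = {v, w}" by blast
    then have "{v, w} \<in> f" using e by simp
    then have "(v, w) \<in> D \<or> (w, v) \<in> D"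
      using oriented unfolding oriented_hfpl_def orientation_def by blast
    then show "e \<in> (\<lambda>w. {v, w}) ` ({w. (w, v) \<in> D} \<union> {w. (v, w) \<in> D})" using w by blast
  next
    fix e assume "e \<in> (\<lambda>w. {v, w}) ` ({w. (w, v) \<in> D} \<union> {w. (v, w) \<in> D})"
    then obtain w where w: "e = {v, w}" "(w, v) \<in> D \<or> (v, w) \<in> D" by blast
    have "{w, v} = {v, w}" by (rule insert_commute)
    then have "{v, w} \<in> f" using w(2) D_f[of w v] D_f[of v w] by metis
    then show "e \<in> {e \<in> f. v \<in> e}" using w(1) by simp
  qed
  moreover have "inj_on (\<lambda>w. {v, w}) A" for A
    by (rule inj_onI) (simp add: doubleton_eq_iff, blast)
  moreover have "{w. (w, v) \<in> D} \<inter> {w. (v, w) \<in> D} = {}" using D_antisym by blast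
  ultimately show ?thesis
    using fin by (simp add: degree_def in_deg_def out_deg_def card_image card_Un_disjoint)
qed

section \<open>Coordinates of the distinguished vertices\<close>

lemma mem_LT: "(x, y) \<in> LT ` {1..K} \<longleftrightarrow> 0 \<le> x \<and> x < int K \<and> y = x"
  by (auto simp: LT_def image_iff intro!: bexI[of _ "nat (x + 1)"])

lemma mem_LB: "(x, y) \<in> LB ` {1..M + N - K} \<longleftrightarrow> 0 \<le> x \<and> x < int M + int N - int K \<and> y = - x - 1"
  using K_le by (auto simp: LB_def image_iff intro!: bexI[of _ "nat (x + 1)"])

lemma mem_RT: "(x, y) \<in> RT K L ` {1..M} \<longleftrightarrow>
    int K + 2 * int L < x \<and> x \<le> int K + 2 * int L + int M \<and> y = 2 * int K + 2 * int L - x"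
  by (auto simp: RT_def image_iff intro!: bexI[of _ "nat (x - int K - 2 * int L)"])

lemma mem_RB: "(x, y) \<in> RB K L M N ` {1..N} \<longleftrightarrow>
    int K + int M - int N + 2 * int L < x \<and> x \<le> int K + int M + 2 * int L \<and>
    y = x - 2 * int M - 2 * int L - 1"
  by (auto simp: RB_def image_iff intro!: bexI[of _ "nat (x - int K - int M + int N - 2 * int L)"])

lemma mem_TT: "(x, y) \<in> TT K ` {1..L} \<longleftrightarrow>
    int K < x \<and> x \<le> int K - 1 + 2 * int L \<and> y = int K - 1 \<and> even (x + y)"
proof
  assume "int K < x \<and> x \<le> int K - 1 + 2 * int L \<and> y = int K - 1 \<and> even (x + y)"
  moreover from this have "even (x + y)" by blast
  then obtain k where "x + y = 2 * k" by (rule evenE)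
  ultimately show "(x, y) \<in> TT K ` {1..L}"
    by (auto simp: TT_def image_iff intro!: bexI[of _ "nat (k - int K + 1)"])
qed (auto simp: TT_def)

lemma mem_BB: "(x, y) \<in> BB K M N ` {1..K + L - N} \<longleftrightarrow>
    int M + int N - int K < x \<and> x \<le> int M - int N + int K - 1 + 2 * int L \<and>
    y = int K - int M - int N \<and> odd (x + y)"
proof
  assume "int M + int N - int K < x \<and> x \<le> int M - int N + int K - 1 + 2 * int L \<and>
    y = int K - int M - int N \<and> odd (x + y)"
  moreover from this have "odd (x + y)" by blast
  then obtain k where "x + y = 2 * k + 1" by (rule oddE)
  ultimately show "(x, y) \<in> BB K M N ` {1..K + L - N}"
    using N_le by (auto simp: BB_def Let_def image_iff intro!: bexI[of _ "nat (k + 1)"])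
qed (use N_le in \<open>auto simp: BB_def Let_def\<close>)

lemma sizes: "int K \<le> int M + int N" "int N \<le> int K + int L" "1 \<le> int M + int N"
  using K_le N_le MN by linarith+

lemmas mem_left = left_verts_def Un_iff mem_LT mem_LB
lemmas mem_right = right_verts_def Un_iff mem_RT mem_RB
lemmas mem_mid = mid_verts_def Un_iff mem_TT mem_BB

text \<open>Links the combinatorial boundary to the existence of horizontal links, on which
  \<open>sink\<close> and \<open>src\<close> depend.\<close>

lemma left_iff: "(x, y) \<in> left_verts K L M N \<longleftrightarrow> V x y \<and> \<not> V (x - 1) y"
  using sizes unfolding mem_left V_iff by auto

lemma right_iff: "(x, y) \<in> right_verts K L M N \<longleftrightarrow> V x y \<and> \<not> V (x + 1) y"
  using sizes unfolding mem_right V_iff by auto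

lemma left_right_disjoint: "(x, y) \<in> left_verts K L M N \<Longrightarrow> (x, y) \<notin> right_verts K L M N"
  using sizes unfolding mem_left mem_right by auto

lemma mid_V: "(x, y) \<in> mid_verts K L M N \<Longrightarrow> V x y \<and> V (x - 1) y \<and> V (x + 1) y"
  using sizes unfolding mem_mid V_iff by auto

lemma degrees:
  "v \<in> left_verts K L M N \<union> right_verts K L M N \<Longrightarrow> degree f v = 0 \<or> degree f v = 1"
  "v \<in> mid_verts K L M N \<Longrightarrow> degree f v = 1"
  "v \<in> H_verts K L M N \<Longrightarrow> v \<notin> left_verts K L M N \<union> right_verts K L M N \<union> mid_verts K L M N \<Longrightarrow>
     degree f v = 2"
  "v \<in> H_verts K L M N \<Longrightarrow> degree f v = 2 \<Longrightarrow> in_deg D v = 1 \<and> out_deg D v = 1"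
  using oriented unfolding oriented_hfpl_def hfpl_def by blast+

lemma left_deg:
  assumes "(x, y) \<in> left_verts K L M N"
  shows "in_deg D (x, y) = 0" "out_deg D (x, y) \<le> 1"
proof -
  have "{v. (v, (x, y)) \<in> D} = {}"
    using oriented assms unfolding oriented_hfpl_def by blast
  then show 0: "in_deg D (x, y) = 0" by (simp only: in_deg_def card.empty)
  have "degree f (x, y) \<le> 1"
    using assms degrees(1)[of "(x, y)"] by auto
  then show "out_deg D (x, y) \<le> 1" using 0 by (simp add: degree_eq)
qed

lemma right_deg:
  assumes "(x, y) \<in> right_verts K L M N"
  shows "out_deg D (x, y) = 0" "in_deg D (x, y) \<le> 1"
proof -
  have "{v. ((x, y), v) \<in> D} = {}"
    using oriented assms unfolding oriented_hfpl_def by blast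
  then show 0: "out_deg D (x, y) = 0" by (simp only: out_deg_def card.empty)
  have "degree f (x, y) \<le> 1"
    using assms degrees(1)[of "(x, y)"] by auto
  then show "in_deg D (x, y) \<le> 1" using 0 by (simp add: degree_eq)
qed

lemma mid_deg: "(x, y) \<in> mid_verts K L M N \<Longrightarrow> in_deg D (x, y) + out_deg D (x, y) = 1"
  using degrees(2)[of "(x, y)"] by (simp add: degree_eq)

lemma inner_deg:
  assumes "V x y" "(x, y) \<notin> left_verts K L M N \<union> right_verts K L M N \<union> mid_verts K L M N"
  shows "in_deg D (x, y) = 1" "out_deg D (x, y) = 1"
  using degrees(3,4)[of "(x, y)"] assms by (simp_all add: V_def)

lemma outside_deg: "\<not> V x y \<Longrightarrow> in_deg D (x, y) = 0 \<and> out_deg D (x, y) = 0"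
proof -
  assume "\<not> V x y"
  then have "{v. (v, (x, y)) \<in> D} = {}" "{v. ((x, y), v) \<in> D} = {}"
    by (auto dest: D_edge)
  then show ?thesis by (simp only: in_deg_def out_deg_def card.empty)
qed

text \<open>At a right vertex both the link to the right and the outgoing edge are missing, at an
  inner vertex both are present; in either case the two terms of \<open>sink\<close> cancel.\<close>

lemma sink_cases:
  assumes "sink x y \<noteq> 0"
  shows "(x, y) \<in> left_verts K L M N \<union> mid_verts K L M N"
proof (rule ccontr)
  assume n: "(x, y) \<notin> left_verts K L M N \<union> mid_verts K L M N"
  show False
  proof (cases "(x, y) \<in> right_verts K L M N")
    case True
    then show ?thesis using assms right_deg(1) right_iff by (simp add: sink_def)
  next
    case False
    then show ?thesis
      using assms n outside_deg inner_deg right_iff by (cases "V x y") (auto simp: sink_def)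
  qed
qed

lemma src_cases:
  assumes "src x y \<noteq> 0"
  shows "(x, y) \<in> right_verts K L M N \<union> mid_verts K L M N"
proof (rule ccontr)
  assume n: "(x, y) \<notin> right_verts K L M N \<union> mid_verts K L M N"
  show False
  proof (cases "(x, y) \<in> left_verts K L M N")
    case True
    then show ?thesis using assms left_deg(1) left_iff by (simp add: src_def)
  next
    case False
    then show ?thesis
      using assms n outside_deg inner_deg left_iff by (cases "V x y") (auto simp: src_def)
  qed
qed

text \<open>A middle vertex has both horizontal links but a single edge, incoming or outgoing, so it
  is either a sink or a source. Elsewhere sinks are left and sources are right vertices.\<close>

lemma sink_src: "sink x y * src x y = 0"
proof (cases "(x, y) \<in> mid_verts K L M N")
  case True
  then have "in_deg D (x, y) = 0 \<or> out_deg D (x, y) = 0"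
    "in_deg D (x, y) = 1 \<or> out_deg D (x, y) = 1" using mid_deg by fastforce+
  then show ?thesis using mid_V[OF True] mid_deg[OF True] by (auto simp: sink_def src_def)
next
  case False
  then show ?thesis using sink_cases src_cases left_right_disjoint by fastforce
qed

text \<open>Parity separates the three top families, with nothing above them, from the three bottom
  families.\<close>

lemma even_top: "even (x + y) \<Longrightarrow>
    (x, y) \<in> left_verts K L M N \<union> right_verts K L M N \<union> mid_verts K L M N \<Longrightarrow>
    y < y' \<Longrightarrow> \<not> V x y'"
  unfolding mem_left mem_right mem_mid V_iff by auto

lemma odd_bottom: "odd (x + y) \<Longrightarrow>
    (x, y) \<in> left_verts K L M N \<union> right_verts K L M N \<union> mid_verts K L M N \<Longrightarrow>
    y' < y \<Longrightarrow> \<not> V x y'"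
  unfolding mem_left mem_right mem_mid V_iff by auto

sublocale lattice_flow size_bound V l r u d sink src
proof
  fix x y y' :: int
  show "V x y \<Longrightarrow> - size_bound < x \<and> x < size_bound \<and> - size_bound < y \<and> y < size_bound"
    by (rule V_bound)
  show "l x y \<noteq> 0 \<Longrightarrow> V x y \<and> V (x - 1) y" using D_edge by (simp add: l_def)
  show "r x y \<noteq> 0 \<Longrightarrow> V x y \<and> V (x + 1) y" using D_edge by (simp add: r_def)
  show "u x y \<noteq> 0 \<Longrightarrow> V x y \<and> V x (y + 1)" using D_edge by (simp add: u_def)
  show "d x y \<noteq> 0 \<Longrightarrow> V x y \<and> V x (y - 1)" using D_edge by (simp add: d_def)
  show "l x y + r x y + u x y + d x y + sink x y = of_bool (V x y \<and> V (x + 1) y)"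
    by (simp add: sink_def out_deg_eq)
  show "l (x + 1) y + r (x - 1) y + u x (y - 1) + d x (y + 1) + src x y
      = of_bool (V x y \<and> V (x - 1) y)"
    by (simp add: src_def in_deg_eq)
  show "l x y * r (x - 1) y = 0" using D_antisym by (auto simp: l_def r_def)
  show "u x y * d x (y + 1) = 0" using D_antisym by (auto simp: u_def d_def)
  show "sink x y * src x y = 0" by (rule sink_src)
  show "even (x + y) \<Longrightarrow> sink x y \<noteq> 0 \<or> src x y \<noteq> 0 \<Longrightarrow> y < y' \<Longrightarrow> \<not> V x y'"
    using even_top sink_cases src_cases by blast
  show "odd (x + y) \<Longrightarrow> sink x y \<noteq> 0 \<or> src x y \<noteq> 0 \<Longrightarrow> y' < y \<Longrightarrow> \<not> V x y'"
    using odd_bottom sink_cases src_cases by blast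
qed

lemma D_box: "((x, y), q) \<in> D \<Longrightarrow>
    - size_bound \<le> x \<and> x \<le> size_bound \<and> - size_bound \<le> y \<and> y \<le> size_bound"
  using D_edge[of x y "fst q" "snd q"] V_bound[of x y] by auto

lemma weight_counts:
  "int (num_edges D dir_down odd_vertex even_vertex
              + num_edges D dir_up even_vertex odd_vertex
              + num_turns D dir_left dir_left odd_vertex
              + num_turns D dir_left dir_left even_vertex
              + num_turns D dir_down dir_left even_vertex
              + num_turns D dir_up dir_left odd_vertex
              + num_turns D dir_left dir_down odd_vertex
              + num_turns D dir_left dir_up even_vertex) = grid_sum size_bound weight"
proof -
  have e: "int (num_edges D a P Q)
      = grid_sum size_bound (\<lambda>x y. of_bool (((x, y), (x, y) + a) \<in> D \<and> P (x, y) \<and> Q ((x, y) + a)))" for a P Q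
    unfolding num_edges_eq by (subst card_eq_grid_sum[where n = size_bound]) (use D_box in blast, simp)
  have t: "int (num_turns D a b P)
      = grid_sum size_bound (\<lambda>x y. of_bool (((x, y) - a, (x, y)) \<in> D \<and> ((x, y), (x, y) + b) \<in> D \<and> P (x, y)))"
    for a b P
    unfolding num_turns_eq by (subst card_eq_grid_sum[where n = size_bound]) (use D_box in blast, simp)
  show ?thesis
    unfolding of_nat_add e t grid_sum_add[symmetric]
    by (intro arg_cong[where f = "grid_sum size_bound"] ext)
       (auto simp: weight_def l_def u_def d_def odd_vertex_def even_vertex_def)
qed

end

section \<open>Inversions of binary words\<close>

definition binary_word :: "(nat \<Rightarrow> bool) \<Rightarrow> nat \<Rightarrow> word" where
  "binary_word a n = map (\<lambda>i. if a i then 1 else 0) [1..<n + 1]"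

lemma binary_word_Suc: "binary_word a (Suc n) = binary_word a n @ [if a (Suc n) then 1 else 0]"
  by (simp add: binary_word_def)

lemma count_list_1_binary_word: "int (count_list (binary_word a n) 1) = (\<Sum>i=1..n. of_bool (a i))"
  by (induction n) (simp_all add: binary_word_Suc, simp add: binary_word_def)

lemma count_list_0_binary_word: "int (count_list (binary_word a n) 0) = (\<Sum>i=1..n. of_bool (\<not> a i))"
  by (induction n) (simp_all add: binary_word_Suc, simp add: binary_word_def)

lemma count_list_conv_card: "count_list w c = card {i. i < length w \<and> w ! i = c}"
  by (simp add: count_list_eq_length_filter length_filter_conv_card eq_commute)

lemma word_d_snoc: "word_d (w @ [c]) = word_d w + (if c = 0 then count_list w 1 else 0)"
proof -
  let ?A = "{(i, j). i < j \<and> j < length w \<and> w ! i = 1 \<and> w ! j = 0}"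
  let ?B = "{i. i < length w \<and> w ! i = 1 \<and> c = 0}"
  have "{(i, j). i < j \<and> j < length (w @ [c]) \<and> (w @ [c]) ! i = 1 \<and> (w @ [c]) ! j = 0}
      = ?A \<union> (\<lambda>i. (i, length w)) ` ?B"
    by (auto simp: nth_append less_Suc_eq image_iff split: if_splits)
  moreover have "finite ?A"
    by (rule finite_subset[of _ "{..<length w} \<times> {..<length w}"]) auto
  moreover have "?A \<inter> (\<lambda>i. (i, length w)) ` ?B = {}" by auto
  moreover have "card ((\<lambda>i. (i, length w)) ` ?B) = card ?B"
    by (rule card_image) (simp add: inj_on_def)
  ultimately have "word_d (w @ [c]) = word_d w + card ?B"
    unfolding word_d_def by (simp add: card_Un_disjoint)
  then show ?thesis by (simp add: count_list_conv_card)
qed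

lemma word_d_binary_word_Suc:
  "int (word_d (binary_word a (Suc n)))
   = int (word_d (binary_word a n)) + of_bool (\<not> a (Suc n)) * (\<Sum>i=1..n. of_bool (a i))"
  using count_list_1_binary_word[of a n] by (simp add: binary_word_Suc word_d_snoc)

lemma word_d_binary_word_0: "word_d (binary_word a 0) = 0"
  by (simp add: binary_word_def word_d_def)

lemma sum_of_bool_not: "(\<Sum>i=1..n. of_bool (\<not> a i)) = int n - (\<Sum>i=1..n. of_bool (a i))"
  by (induction n) auto

text \<open>The number of ones before a zero is its position minus its rank among the zeros; for z
  zeros the ranks add up to z(z + 1)/2.\<close>

lemma word_d_zeros:
  "2 * int (word_d (binary_word a n)) = 2 * (\<Sum>i=1..n. int i * of_bool (\<not> a i))
     - (\<Sum>i=1..n. of_bool (\<not> a i)) - (\<Sum>i=1..n. of_bool (\<not> a i))\<^sup>2"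
proof (induction n)
  case (Suc n)
  then show ?case
    using sum_of_bool_not[of a n]
    by (cases "a (Suc n)")
      (simp_all add: word_d_binary_word_Suc sum_of_bool_not power2_eq_square algebra_simps
        \<comment> \<open>These rules would rewrite the indicator sums into cardinalities and sums
          over filtered index sets.\<close>
        del: sum_of_bool_eq sum_mult_of_bool_eq)
qed (simp add: word_d_binary_word_0)

text \<open>Dually, a one at position i is followed by n - i letters; for k ones, the k(k - 1)/2
  pairs of ones have to be discarded.\<close>

lemma word_d_ones:
  "2 * int (word_d (binary_word a n)) = - 2 * (\<Sum>i=1..n. int i * of_bool (a i))
     + (2 * int n + 1) * (\<Sum>i=1..n. of_bool (a i)) - (\<Sum>i=1..n. of_bool (a i))\<^sup>2"
proof (induction n)
  case (Suc n)
  then show ?case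
    using sum_of_bool_not[of a n]
    by (cases "a (Suc n)")
      (simp_all add: word_d_binary_word_Suc sum_of_bool_not power2_eq_square algebra_simps
        del: sum_of_bool_eq sum_mult_of_bool_eq)
qed (simp add: word_d_binary_word_0)

text \<open>A pair of a zero and a one contributes 1 if it is an inversion and -1 otherwise.\<close>

lemma word_d_sgn:
  "(\<Sum>i=1..n. \<Sum>j=1..n. sgn (int i - int j) * of_bool (\<not> a i) * of_bool (a j))
   = 2 * int (word_d (binary_word a n))
     - (\<Sum>i=1..n. of_bool (\<not> a i)) * (\<Sum>i=1..n. of_bool (a i))"
proof (induction n)
  case (Suc n)
  have 1: "(\<Sum>j=1..n. sgn (int (Suc n) - int j) * of_bool (\<not> a (Suc n)) * of_bool (a j))
      = of_bool (\<not> a (Suc n)) * (\<Sum>j=1..n. of_bool (a j))"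
    unfolding sum_distrib_left by (rule sum.cong) auto
  have 2: "(\<Sum>i=1..n. sgn (int i - int (Suc n)) * of_bool (\<not> a i) * of_bool (a (Suc n)))
      = - (\<Sum>i=1..n. of_bool (\<not> a i)) * of_bool (a (Suc n))"
    unfolding sum_distrib_right sum_negf[symmetric] by (rule sum.cong) auto
  show ?case
    using Suc.IH 1 2
    by (cases "a (Suc n)") (simp_all add: sum.distrib word_d_binary_word_Suc algebra_simps)
qed (simp add: word_d_binary_word_0)

section \<open>Boundary terms\<close>

context oriented_configuration
begin

text \<open>Each predicate tells at which positions, counted from 1, the letter is 1. In the sweep,
  blue particles belong to zeros: they vanish at zeros of \<open>lT\<close> and \<open>tT\<close>
  and arise at zeros of \<open>bB\<close> and \<open>rB\<close>. Red ones belong to ones: they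
  vanish at ones of \<open>lB\<close> and \<open>bB\<close> and arise at ones of \<open>tT\<close>
  and \<open>rT\<close>.\<close>

definition lT where "lT i \<longleftrightarrow> out_deg D (LT i) = 1"
definition tT where "tT i \<longleftrightarrow> in_deg D (TT K i) \<noteq> 1"
definition rT where "rT i \<longleftrightarrow> in_deg D (RT K L i) \<noteq> 1"
definition rB where "rB i \<longleftrightarrow> in_deg D (RB K L M N i) = 1"
definition bB where "bB i \<longleftrightarrow> in_deg D (BB K M N i) = 1"
definition lB where "lB i \<longleftrightarrow> out_deg D (LB i) \<noteq> 1"

lemma boundary_eq:
  "boundary K L M N D = (binary_word lT K, binary_word tT L, binary_word rT M,
     binary_word rB N, binary_word bB (K + L - N), binary_word lB (M + N - K))"
  by (auto simp: boundary_def binary_word_def lT_def tT_def rT_def rB_def bB_def lB_def)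

lemma sink_left: "(x, y) \<in> left_verts K L M N \<Longrightarrow> sink x y = of_bool (out_deg D (x, y) \<noteq> 1)"
proof -
  assume a: "(x, y) \<in> left_verts K L M N"
  have "V x y \<and> V (x + 1) y" using a left_iff right_iff left_right_disjoint by blast
  then show ?thesis using left_deg(2)[OF a] by (auto simp: sink_def)
qed

lemma src_right: "(x, y) \<in> right_verts K L M N \<Longrightarrow> src x y = of_bool (in_deg D (x, y) \<noteq> 1)"
proof -
  assume a: "(x, y) \<in> right_verts K L M N"
  have "V x y \<and> V (x - 1) y" using a left_iff right_iff left_right_disjoint by blast
  then show ?thesis using right_deg(2)[OF a] by (auto simp: src_def)
qed

lemma sink_mid: "(x, y) \<in> mid_verts K L M N \<Longrightarrow> sink x y = of_bool (in_deg D (x, y) = 1)"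
  using mid_V[of x y] mid_deg[of x y] by (auto simp: sink_def)

lemma src_mid: "(x, y) \<in> mid_verts K L M N \<Longrightarrow> src x y = of_bool (in_deg D (x, y) \<noteq> 1)"
  using mid_V[of x y] mid_deg[of x y] by (auto simp: src_def)

section \<open>Sinks and sources read off the boundary words\<close>

lemma bsink_LT: "i \<in> {1..K} \<Longrightarrow> bsink (int i - 1) (int i - 1) = of_bool (\<not> lT i)"
  using sink_left[of "int i - 1" "int i - 1"]
  by (auto simp: bsink_def lT_def LT_def mem_left)

lemma bsink_TT: "i \<in> {1..L} \<Longrightarrow> bsink (int K - 1 + 2 * int i) (int K - 1) = of_bool (\<not> tT i)"
  using sink_mid[of "int K - 1 + 2 * int i" "int K - 1"]
  by (auto simp: bsink_def tT_def TT_def mem_mid)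

lemma rsrc_TT: "i \<in> {1..L} \<Longrightarrow> rsrc (int K - 1 + 2 * int i) (int K - 1) = of_bool (tT i)"
  using src_mid[of "int K - 1 + 2 * int i" "int K - 1"]
  by (auto simp: rsrc_def tT_def TT_def mem_mid)

lemma rsrc_RT: "i \<in> {1..M} \<Longrightarrow> rsrc (int K + 2 * int L + int i) (int K - int i) = of_bool (rT i)"
  using src_right[of "int K + 2 * int L + int i" "int K - int i"]
  by (auto simp: rsrc_def rT_def RT_def mem_right)

lemma bsrc_RB: "i \<in> {1..N} \<Longrightarrow>
    bsrc (int K + int M - int N + 2 * int L + int i) (int K - int M - int N - 1 + int i)
    = of_bool (\<not> rB i)"
  using src_right[of "int K + int M - int N + 2 * int L + int i" "int K - int M - int N - 1 + int i"]
  by (auto simp: bsrc_def rB_def RB_def mem_right)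

lemma BB_eq: "BB K M N i = (int M + int N - int K - 1 + 2 * int i, int K - int M - int N)"
  by (simp add: BB_def Let_def)

lemma bsrc_BB: "i \<in> {1..K + L - N} \<Longrightarrow>
    bsrc (int M + int N - int K - 1 + 2 * int i) (int K - int M - int N) = of_bool (\<not> bB i)"
  using src_mid[of "int M + int N - int K - 1 + 2 * int i" "int K - int M - int N"] N_le
  by (auto simp: bsrc_def bB_def BB_eq mem_mid)

lemma rsink_BB: "i \<in> {1..K + L - N} \<Longrightarrow>
    rsink (int M + int N - int K - 1 + 2 * int i) (int K - int M - int N) = of_bool (bB i)"
  using sink_mid[of "int M + int N - int K - 1 + 2 * int i" "int K - int M - int N"] N_le
  by (auto simp: rsink_def bB_def BB_eq mem_mid)

lemma rsink_LB: "i \<in> {1..M + N - K} \<Longrightarrow> rsink (int i - 1) (- int i) = of_bool (lB i)"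
  using sink_left[of "int i - 1" "- int i"] K_le
  by (auto simp: rsink_def lB_def LB_def mem_left)

text \<open>In this and the three analogous formulas \<open>g\<close> is arbitrary, to cover the
  potentials, the sign sums of the pairings and, with the constant 1, the particle counts.\<close>

lemma grid_sum_bsink:
  "grid_sum size_bound (\<lambda>x y. g x y * bsink x y)
   = (\<Sum>i=1..K. g (int i - 1) (int i - 1) * of_bool (\<not> lT i))
   + (\<Sum>i=1..L. g (int K - 1 + 2 * int i) (int K - 1) * of_bool (\<not> tT i))"
proof -
  have "grid_sum size_bound (\<lambda>x y. g x y * bsink x y) =
      (\<Sum>i=1..K. g (fst (LT i)) (snd (LT i)) * bsink (fst (LT i)) (snd (LT i)))
    + (\<Sum>i=1..L. g (fst (TT K i)) (snd (TT K i)) * bsink (fst (TT K i)) (snd (TT K i)))"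
  proof (rule grid_sum_two_families)
    show "(x, y) \<in> LT ` {1..K} \<union> TT K ` {1..L}" if "g x y * bsink x y \<noteq> 0" for x y
    proof -
      have "even (x + y)" "sink x y \<noteq> 0" using that by (auto simp: bsink_def split: if_splits)
      then show ?thesis using sink_cases[of x y] unfolding mem_left mem_mid by auto
    qed
    show "- size_bound \<le> x \<and> x \<le> size_bound \<and> - size_bound \<le> y \<and> y \<le> size_bound"
      if "(x, y) \<in> LT ` {1..K} \<union> TT K ` {1..L}" for x y
      using that unfolding Un_iff mem_LT mem_TT size_bound_def by auto
    show "(x, y) \<in> LT ` {1..K} \<Longrightarrow> (x, y) \<notin> TT K ` {1..L}" for x y
      unfolding mem_LT mem_TT by auto
  qed (auto simp: inj_on_def LT_def TT_def)
  then show ?thesis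
    unfolding LT_def TT_def fst_conv snd_conv by (simp only: bsink_LT bsink_TT cong: sum.cong)
qed

lemma grid_sum_rsrc:
  "grid_sum size_bound (\<lambda>x y. g x y * rsrc x y)
   = (\<Sum>i=1..L. g (int K - 1 + 2 * int i) (int K - 1) * of_bool (tT i))
   + (\<Sum>i=1..M. g (int K + 2 * int L + int i) (int K - int i) * of_bool (rT i))"
proof -
  have "grid_sum size_bound (\<lambda>x y. g x y * rsrc x y) =
      (\<Sum>i=1..L. g (fst (TT K i)) (snd (TT K i)) * rsrc (fst (TT K i)) (snd (TT K i)))
    + (\<Sum>i=1..M. g (fst (RT K L i)) (snd (RT K L i)) * rsrc (fst (RT K L i)) (snd (RT K L i)))"
  proof (rule grid_sum_two_families)
    show "(x, y) \<in> TT K ` {1..L} \<union> RT K L ` {1..M}" if "g x y * rsrc x y \<noteq> 0" for x y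
    proof -
      have "even (x + y)" "src x y \<noteq> 0" using that by (auto simp: rsrc_def split: if_splits)
      then show ?thesis using src_cases[of x y] unfolding mem_right mem_mid by auto
    qed
    show "- size_bound \<le> x \<and> x \<le> size_bound \<and> - size_bound \<le> y \<and> y \<le> size_bound"
      if "(x, y) \<in> TT K ` {1..L} \<union> RT K L ` {1..M}" for x y
      using that sizes unfolding Un_iff mem_RT mem_TT size_bound_def by auto
    show "(x, y) \<in> TT K ` {1..L} \<Longrightarrow> (x, y) \<notin> RT K L ` {1..M}" for x y
      unfolding mem_RT mem_TT by auto
  qed (auto simp: inj_on_def RT_def TT_def)
  then show ?thesis
    unfolding RT_def TT_def fst_conv snd_conv by (simp only: rsrc_RT rsrc_TT cong: sum.cong)
qed

lemma grid_sum_bsrc: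
  "grid_sum size_bound (\<lambda>x y. g x y * bsrc x y)
   = (\<Sum>i=1..K + L - N. g (int M + int N - int K - 1 + 2 * int i) (int K - int M - int N)
        * of_bool (\<not> bB i))
   + (\<Sum>i=1..N. g (int K + int M - int N + 2 * int L + int i) (int K - int M - int N - 1 + int i)
        * of_bool (\<not> rB i))"
proof -
  have "grid_sum size_bound (\<lambda>x y. g x y * bsrc x y) =
      (\<Sum>i=1..K + L - N. g (fst (BB K M N i)) (snd (BB K M N i))
        * bsrc (fst (BB K M N i)) (snd (BB K M N i)))
    + (\<Sum>i=1..N. g (fst (RB K L M N i)) (snd (RB K L M N i))
        * bsrc (fst (RB K L M N i)) (snd (RB K L M N i)))"
  proof (rule grid_sum_two_families)
    show "(x, y) \<in> BB K M N ` {1..K + L - N} \<union> RB K L M N ` {1..N}"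
      if "g x y * bsrc x y \<noteq> 0" for x y
    proof -
      have "odd (x + y)" "src x y \<noteq> 0" using that by (auto simp: bsrc_def split: if_splits)
      then show ?thesis using src_cases[of x y] unfolding mem_right mem_mid by auto
    qed
    show "- size_bound \<le> x \<and> x \<le> size_bound \<and> - size_bound \<le> y \<and> y \<le> size_bound"
      if "(x, y) \<in> BB K M N ` {1..K + L - N} \<union> RB K L M N ` {1..N}" for x y
      using that sizes unfolding Un_iff mem_RB mem_BB size_bound_def by auto
    show "(x, y) \<in> BB K M N ` {1..K + L - N} \<Longrightarrow> (x, y) \<notin> RB K L M N ` {1..N}" for x y
      unfolding mem_RB mem_BB by auto
  qed (auto simp: inj_on_def RB_def BB_eq)
  then show ?thesis
    unfolding RB_def BB_eq fst_conv snd_conv by (simp only: bsrc_BB bsrc_RB cong: sum.cong)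
qed

lemma grid_sum_rsink:
  "grid_sum size_bound (\<lambda>x y. g x y * rsink x y)
   = (\<Sum>i=1..M + N - K. g (int i - 1) (- int i) * of_bool (lB i))
   + (\<Sum>i=1..K + L - N. g (int M + int N - int K - 1 + 2 * int i) (int K - int M - int N)
        * of_bool (bB i))"
proof -
  have "grid_sum size_bound (\<lambda>x y. g x y * rsink x y) =
      (\<Sum>i=1..M + N - K. g (fst (LB i)) (snd (LB i)) * rsink (fst (LB i)) (snd (LB i)))
    + (\<Sum>i=1..K + L - N. g (fst (BB K M N i)) (snd (BB K M N i))
        * rsink (fst (BB K M N i)) (snd (BB K M N i)))"
  proof (rule grid_sum_two_families)
    show "(x, y) \<in> LB ` {1..M + N - K} \<union> BB K M N ` {1..K + L - N}"
      if "g x y * rsink x y \<noteq> 0" for x y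
    proof -
      have "odd (x + y)" "sink x y \<noteq> 0" using that by (auto simp: rsink_def split: if_splits)
      then show ?thesis using sink_cases[of x y] unfolding mem_left mem_mid by auto
    qed
    show "- size_bound \<le> x \<and> x \<le> size_bound \<and> - size_bound \<le> y \<and> y \<le> size_bound"
      if "(x, y) \<in> LB ` {1..M + N - K} \<union> BB K M N ` {1..K + L - N}" for x y
      using that sizes unfolding Un_iff mem_LB mem_BB size_bound_def by auto
    show "(x, y) \<in> LB ` {1..M + N - K} \<Longrightarrow> (x, y) \<notin> BB K M N ` {1..K + L - N}" for x y
      unfolding mem_LB mem_BB by auto
  qed (auto simp: inj_on_def LB_def BB_eq)
  then show ?thesis
    unfolding LB_def BB_eq fst_conv snd_conv by (simp only: rsink_BB rsink_LB cong: sum.cong)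
qed

section \<open>Evaluation of the boundary terms\<close>

abbreviation ones :: "(nat \<Rightarrow> bool) \<Rightarrow> nat \<Rightarrow> int" where
  "ones a n \<equiv> \<Sum>i=1..n. of_bool (a i)"
abbreviation zeros :: "(nat \<Rightarrow> bool) \<Rightarrow> nat \<Rightarrow> int" where
  "zeros a n \<equiv> \<Sum>i=1..n. of_bool (\<not> a i)"

lemma sum_eq_times:
  fixes c :: int
  assumes "\<And>i. i \<in> A \<Longrightarrow> h i = c"
  shows "(\<Sum>i\<in>A. h i * z i) = c * (\<Sum>i\<in>A. z i)"
  using assms by (simp add: sum_distrib_left)

lemma sgn_sum_word:
  "(\<Sum>i=1..n. (\<Sum>j=1..n. sgn (2 * int i - 2 * int j) * of_bool (a j)) * of_bool (\<not> a i))
   = 2 * int (word_d (binary_word a n)) - zeros a n * ones a n"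
proof -
  have "sgn (2 * int i - 2 * int j) = sgn (int i - int j)" for i j
    by (simp add: sgn_if)
  then show ?thesis
    unfolding word_d_sgn[symmetric] by (simp add: sum_distrib_left sum_distrib_right ac_simps)
qed

text \<open>From left to right come the families \<open>LT\<close>, \<open>TT\<close>,
  \<open>RT\<close>. Only pairs within \<open>TT\<close> occur in both orders and yield inversions
  of \<open>tT\<close>; in all other pairs the blue sink is to the left of the red source, with sign
  -1.\<close>

lemma sgn_pairing_top_word:
  "sgn_pairing size_bound (col bsink) (col rsrc)
   = 2 * int (word_d (binary_word tT L)) - (zeros lT K + zeros tT L) * (ones tT L + ones rT M)"
proof -
  let ?h = "\<lambda>x. (\<Sum>i=1..L. sgn (x - (int K - 1 + 2 * int i)) * of_bool (tT i))
      + (\<Sum>i=1..M. sgn (x - (int K + 2 * int L + int i)) * of_bool (rT i))"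
  have "sgn_pairing size_bound (col bsink) (col rsrc) = grid_sum size_bound (\<lambda>x y. ?h x * bsink x y)"
    unfolding sgn_pairing_columns grid_sum_rsrc by (simp only: mult.commute)
  also have "\<dots> = (\<Sum>i=1..K. ?h (int i - 1) * of_bool (\<not> lT i))
      + (\<Sum>i=1..L. ?h (int K - 1 + 2 * int i) * of_bool (\<not> tT i))"
    by (rule grid_sum_bsink)
  also have "(\<Sum>i=1..K. ?h (int i - 1) * of_bool (\<not> lT i))
      = (- ones tT L - ones rT M) * zeros lT K"
  proof (rule sum_eq_times)
    fix i assume "i \<in> {1..K}"
    then show "?h (int i - 1) = - ones tT L - ones rT M"
      by (subst (1 2) sum_eq_times[where c = "-1"]) auto
  qed
  also have "(\<Sum>i=1..L. ?h (int K - 1 + 2 * int i) * of_bool (\<not> tT i))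
      = (\<Sum>i=1..L. ((\<Sum>j=1..L. sgn (2 * int i - 2 * int j) * of_bool (tT j)) - ones rT M)
           * of_bool (\<not> tT i))"
  proof (rule sum.cong)
    fix i assume "i \<in> {1..L}"
    then have "(\<Sum>j=1..M. sgn (int K - 1 + 2 * int i - (int K + 2 * int L + int j)) * of_bool (rT j))
        = -1 * ones rT M"
      by (intro sum_eq_times) auto
    then show "?h (int K - 1 + 2 * int i) * of_bool (\<not> tT i)
      = ((\<Sum>j=1..L. sgn (2 * int i - 2 * int j) * of_bool (tT j)) - ones rT M) * of_bool (\<not> tT i)"
      by simp
  qed simp
  also have "\<dots> = 2 * int (word_d (binary_word tT L)) - zeros tT L * ones tT L - ones rT M * zeros tT L"
    unfolding left_diff_distrib sum_subtractf sgn_sum_word by (simp only: sum_distrib_left)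
  finally show ?thesis by (simp add: algebra_simps del: sum_of_bool_eq)
qed

text \<open>From left to right come \<open>LB\<close>, \<open>BB\<close>, \<open>RB\<close>. Outside
  the pairs within \<open>BB\<close>, a blue source is to the right of a red sink, with sign
  1.\<close>

lemma sgn_pairing_bottom_word:
  "sgn_pairing size_bound (col bsrc) (col rsink)
   = 2 * int (word_d (binary_word bB (K + L - N))) - zeros bB (K + L - N) * ones bB (K + L - N)
     + zeros bB (K + L - N) * ones lB (M + N - K)
     + zeros rB N * (ones lB (M + N - K) + ones bB (K + L - N))"
proof -
  let ?s = "M + N - K" and ?c = "K + L - N"
  let ?h = "\<lambda>x. (\<Sum>i=1..?s. sgn (x - (int i - 1)) * of_bool (lB i))
      + (\<Sum>i=1..?c. sgn (x - (int M + int N - int K - 1 + 2 * int i)) * of_bool (bB i))"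
  have s: "int ?s = int M + int N - int K" and c: "int ?c = int K + int L - int N"
    using K_le N_le by auto
  have "sgn_pairing size_bound (col bsrc) (col rsink) = grid_sum size_bound (\<lambda>x y. ?h x * bsrc x y)"
    unfolding sgn_pairing_columns grid_sum_rsink by (simp only: mult.commute)
  also have "\<dots> = (\<Sum>i=1..?c. ?h (int M + int N - int K - 1 + 2 * int i) * of_bool (\<not> bB i))
      + (\<Sum>i=1..N. ?h (int K + int M - int N + 2 * int L + int i) * of_bool (\<not> rB i))"
    by (rule grid_sum_bsrc)
  also have "(\<Sum>i=1..N. ?h (int K + int M - int N + 2 * int L + int i) * of_bool (\<not> rB i))
      = (ones lB ?s + ones bB ?c) * zeros rB N"
  proof (rule sum_eq_times)
    fix i assume "i \<in> {1..N}"
    then show "?h (int K + int M - int N + 2 * int L + int i) = ones lB ?s + ones bB ?c"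
      using s c sizes by (subst (1 2) sum_eq_times[where c = 1]) auto
  qed
  also have "(\<Sum>i=1..?c. ?h (int M + int N - int K - 1 + 2 * int i) * of_bool (\<not> bB i))
      = (\<Sum>i=1..?c. ((\<Sum>j=1..?c. sgn (2 * int i - 2 * int j) * of_bool (bB j)) + ones lB ?s)
           * of_bool (\<not> bB i))"
  proof (rule sum.cong)
    fix i assume "i \<in> {1..?c}"
    then have "(\<Sum>j=1..?s. sgn (int M + int N - int K - 1 + 2 * int i - (int j - 1)) * of_bool (lB j))
        = 1 * ones lB ?s"
      using s by (intro sum_eq_times) auto
    then show "?h (int M + int N - int K - 1 + 2 * int i) * of_bool (\<not> bB i)
      = ((\<Sum>j=1..?c. sgn (2 * int i - 2 * int j) * of_bool (bB j)) + ones lB ?s) * of_bool (\<not> bB i)"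
      by simp
  qed simp
  also have "\<dots> = 2 * int (word_d (binary_word bB ?c)) - zeros bB ?c * ones bB ?c
      + ones lB ?s * zeros bB ?c"
    unfolding distrib_right sum.distrib sgn_sum_word by (simp only: sum_distrib_left)
  finally show ?thesis by (simp add: algebra_simps del: sum_of_bool_eq)
qed

text \<open>Along each boundary family the relevant potential grows by 2 with the index.\<close>

lemma sum_linear:
  fixes h :: "nat \<Rightarrow> int"
  assumes "\<And>i. h i = 2 * int i + c"
  shows "(\<Sum>i=1..n. h i * z i) = 2 * (\<Sum>i=1..n. int i * z i) + c * (\<Sum>i=1..n. z i)"
  by (simp add: assms sum.distrib sum_distrib_left algebra_simps)

text \<open>Up to additive constants, the potentials are twice the positions of the blue letters in
  the concatenations \<open>lT\<close> \<open>tT\<close> and \<open>bB\<close> \<open>rB\<close>,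
  and of the red letters in \<open>tT\<close> \<open>rT\<close> and \<open>lB\<close>
  \<open>bB\<close>. The position sums become inversion numbers.\<close>

theorem grid_sum_weight_words:
  "grid_sum size_bound weight =
     int (word_d (binary_word rB N)) + int (word_d (binary_word bB (K + L - N)))
   + int (word_d (binary_word lB (M + N - K))) - int (word_d (binary_word lT K))
   - int (word_d (binary_word tT L)) - int (word_d (binary_word rT M))
   - ones lT K * zeros tT L - ones tT L * zeros rT M - zeros rB N * ones lB (M + N - K)"
proof -
  let ?s = "M + N - K" and ?c = "K + L - N"
  have s: "int ?s = int M + int N - int K" and c: "int ?c = int K + int L - int N"
    using K_le N_le by auto
  have w1: "grid_sum size_bound (\<lambda>x y. (x + y - 1) * bsrc x y)
      = 2 * (\<Sum>i=1..?c. int i * of_bool (\<not> bB i)) + (-2) * zeros bB ?c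
      + (2 * (\<Sum>i=1..N. int i * of_bool (\<not> rB i)) + (2 * int ?c - 2) * zeros rB N)"
    unfolding grid_sum_bsrc c by (rule arg_cong2[where f = plus]; rule sum_linear; simp)
  have w2: "grid_sum size_bound (\<lambda>x y. (x + y) * bsink x y)
      = 2 * (\<Sum>i=1..K. int i * of_bool (\<not> lT i)) + (-2) * zeros lT K
      + (2 * (\<Sum>i=1..L. int i * of_bool (\<not> tT i)) + (2 * int K - 2) * zeros tT L)"
    unfolding grid_sum_bsink by (rule arg_cong2[where f = plus]; rule sum_linear; simp)
  have w3: "grid_sum size_bound (\<lambda>x y. (x - y - 1) * rsrc x y)
      = 2 * (\<Sum>i=1..L. int i * of_bool (tT i)) + (-1) * ones tT L
      + (2 * (\<Sum>i=1..M. int i * of_bool (rT i)) + (2 * int L - 1) * ones rT M)"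
    unfolding grid_sum_rsrc by (rule arg_cong2[where f = plus]; rule sum_linear; simp)
  have w4: "grid_sum size_bound (\<lambda>x y. (x - y) * rsink x y)
      = 2 * (\<Sum>i=1..?s. int i * of_bool (lB i)) + (-1) * ones lB ?s
      + (2 * (\<Sum>i=1..?c. int i * of_bool (bB i)) + (2 * int ?s - 1) * ones bB ?c)"
    unfolding grid_sum_rsink s by (rule arg_cong2[where f = plus]; rule sum_linear; simp)
  \<comment> \<open>Conservation of both colours, to match the products and squares of letter counts
    at the top with those at the bottom.\<close>
  have blue: "zeros lT K + zeros tT L = zeros bB ?c + zeros rB N"
    using grid_sum_bsink_bsrc grid_sum_bsink[of "\<lambda>x y. 1"] grid_sum_bsrc[of "\<lambda>x y. 1"]
    by (simp del: sum_of_bool_eq)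
  have red: "ones lB ?s + ones bB ?c = ones tT L + ones rT M"
    using grid_sum_rsink_rsrc grid_sum_rsink[of "\<lambda>x y. 1"] grid_sum_rsrc[of "\<lambda>x y. 1"]
    by (simp del: sum_of_bool_eq)
  \<comment> \<open>The letters of \<open>tT\<close> and \<open>bB\<close> concern both colours, so
    these two words need both formulas.\<close>
  note d = word_d_zeros[of lT K] word_d_zeros[of tT L] word_d_zeros[of rB N] word_d_zeros[of bB ?c]
    word_d_ones[of tT L] word_d_ones[of rT M] word_d_ones[of lB ?s] word_d_ones[of bB ?c]
  note compl = sum_of_bool_not[of lT K] sum_of_bool_not[of tT L] sum_of_bool_not[of rT M]
    sum_of_bool_not[of bB ?c]
  show ?thesis
    using grid_sum_weight[unfolded w1 w2 w3 w4 sgn_pairing_top_word sgn_pairing_bottom_word] blue red d compl s c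
    by algebra
qed

end

theorem theorem4p4:
  fixes K L M N :: nat
    and f :: "vertex set set"
    and D :: "(vertex \<times> vertex) set"
    and l_T t r_T r_B b l_B :: word
  assumes "K \<le> M + N" and "N \<le> K + L" and "M + N \<ge> 1"
    and "oriented_hfpl K L M N f D"
    and "boundary K L M N D = (l_T, t, r_T, r_B, b, l_B)"
  shows "int (word_d r_B) + int (word_d b) + int (word_d l_B)
           - int (word_d l_T) - int (word_d t) - int (word_d r_T)
           - int (count_list l_T 1 * count_list t 0)
           - int (count_list t 1 * count_list r_T 0)
           - int (count_list r_B 0 * count_list l_B 1)
         = int (num_edges D dir_down odd_vertex even_vertex
              + num_edges D dir_up even_vertex odd_vertex
              + num_turns D dir_left dir_left odd_vertex
              + num_turns D dir_left dir_left even_vertex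
              + num_turns D dir_down dir_left even_vertex
              + num_turns D dir_up dir_left odd_vertex
              + num_turns D dir_left dir_down odd_vertex
              + num_turns D dir_left dir_up even_vertex)"
proof -
  interpret oriented_configuration K L M N f D
    using assms(1-4) by unfold_locales
  have w: "l_T = binary_word lT K" "t = binary_word tT L" "r_T = binary_word rT M"
    "r_B = binary_word rB N" "b = binary_word bB (K + L - N)" "l_B = binary_word lB (M + N - K)"
    using assms(5) by (simp_all add: boundary_eq)
  show ?thesis
    unfolding weight_counts grid_sum_weight_words w of_nat_mult
      count_list_0_binary_word count_list_1_binary_word by (rule refl)
qed

end
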